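(* A finite abelian $2$-group is an $\mathrm{NCI}^{(2)}$-group if and only if it is isomorphic to $C_4$ or to $C_2^k$ for some integer $0\leq k\leq 5$.
   Context: $C_n$ denotes the cyclic group of order $n$. Let $G$ be a finite group and $\mathrm{Sym}(G)$ the group of all permutations of the set $G$. Let $G_r\leq \mathrm{Sym}(G)$ be the group of all right translations $x\mapsto xg$, $g\in G$, and let $\mathrm{Hol}(G)=N_{\mathrm{Sym}(G)}(G_r)=G_r\rtimes \mathrm{Aut}(G)$. For $K\leq \mathrm{Sym}(G)$, the 2-closure $K^{(2)}$ is the largest subgroup of $\mathrm{Sym}(G)$ having the same orbits on $G\times G$ (under componentwise action) as $K$; $K$ is 2-closed if $K^{(2)}=K$. A subgroup of $\mathrm{Sym}(G)$ is $G$-regular if it is regular on $G$ and isomorphic to $G$. A group $K$ with $G_r\leq K\leq \mathrm{Sym}(G)$ is $G$-transjugate if every $G$-regular subgroup of $K$ is conjugate in $K$ to $G_r$. The group $G$ is an $\mathrm{NCI}^{(2)}$-group if every 2-closed group $K$ with $G_r\leq K\leq \mathrm{Hol}(G)$ is $G$-transjugate. *)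

theory Defs
  imports "HOL-Algebra.Algebra"
begin

text \<open>
  \<open>Sym(G)\<close> is \<open>BijGroup (carrier G)\<close>: its elements are the bijections of \<open>carrier G\<close> that are
  \<open>undefined\<close> outside \<open>carrier G\<close>. Subgroups of \<open>Sym(G)\<close> are represented by their element sets.
\<close>

abbreviation Sym :: "('a, 'b) monoid_scheme \<Rightarrow> ('a \<Rightarrow> 'a) monoid"
  where "Sym G \<equiv> BijGroup (carrier G)"

definition right_translations :: "('a, 'b) monoid_scheme \<Rightarrow> ('a \<Rightarrow> 'a) set"
  where "right_translations G =
    {(\<lambda>x \<in> carrier G. x \<otimes>\<^bsub>G\<^esub> g) | g. g \<in> carrier G}"

definition holomorph :: "('a, 'b) monoid_scheme \<Rightarrow> ('a \<Rightarrow> 'a) set"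
  where "holomorph G = normalizer (Sym G) (right_translations G)"

definition orbitals :: "('a, 'b) monoid_scheme \<Rightarrow> ('a \<Rightarrow> 'a) set \<Rightarrow> ('a \<times> 'a) set set"
  where "orbitals G K =
    orbits ((Sym G)\<lparr>carrier := K\<rparr>) (carrier G \<times> carrier G) (\<lambda>f. map_prod f f)"

text \<open>
  \<open>GREATEST\<close> is with respect to inclusion and is a definite description; \<open>two_closure_greatest\<close>
  below shows that the largest subgroup exists whenever \<open>K\<close> is a subgroup.
\<close>

definition two_closure :: "('a, 'b) monoid_scheme \<Rightarrow> ('a \<Rightarrow> 'a) set \<Rightarrow> ('a \<Rightarrow> 'a) set"
  where "two_closure G K =
    (GREATEST L. subgroup L (Sym G) \<and> orbitals G L = orbitals G K)"

definition two_closed :: "('a, 'b) monoid_scheme \<Rightarrow> ('a \<Rightarrow> 'a) set \<Rightarrow> bool"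
  where "two_closed G K \<longleftrightarrow> two_closure G K = K"

definition regular_on :: "'a set \<Rightarrow> ('a \<Rightarrow> 'a) set \<Rightarrow> bool"
  where "regular_on S R \<longleftrightarrow>
    transitive_action ((BijGroup S)\<lparr>carrier := R\<rparr>) S (\<lambda>f. f) \<and>
    (\<forall>x \<in> S. stabilizer ((BijGroup S)\<lparr>carrier := R\<rparr>) (\<lambda>f. f) x = {\<one>\<^bsub>BijGroup S\<^esub>})"

definition G_regular :: "('a, 'b) monoid_scheme \<Rightarrow> ('a \<Rightarrow> 'a) set \<Rightarrow> bool"
  where "G_regular G R \<longleftrightarrow>
    subgroup R (Sym G) \<and> regular_on (carrier G) R \<and> (Sym G)\<lparr>carrier := R\<rparr> \<cong> G"

definition G_transjugate :: "('a, 'b) monoid_scheme \<Rightarrow> ('a \<Rightarrow> 'a) set \<Rightarrow> bool"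
  where "G_transjugate G K \<longleftrightarrow>
    subgroup K (Sym G) \<and> right_translations G \<subseteq> K \<and>
    (\<forall>R. G_regular G R \<and> R \<subseteq> K \<longrightarrow>
      (\<exists>k \<in> K. R = k <#\<^bsub>Sym G\<^esub> right_translations G #>\<^bsub>Sym G\<^esub> inv\<^bsub>Sym G\<^esub> k))"

definition NCI2_group :: "('a, 'b) monoid_scheme \<Rightarrow> bool"
  where "NCI2_group G \<longleftrightarrow>
    (\<forall>K. subgroup K (Sym G) \<and> two_closed G K \<and>
         right_translations G \<subseteq> K \<and> K \<subseteq> holomorph G \<longrightarrow> G_transjugate G K)"

abbreviation cyclic_power :: "nat \<Rightarrow> nat \<Rightarrow> (nat \<Rightarrow> int) monoid"
  where "cyclic_power n k \<equiv> product_group {..<k} (\<lambda>_. integer_mod_group n)"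

lemma orbit_map_prod:
  "orbit ((Sym G)\<lparr>carrier := K\<rparr>) (\<lambda>f. map_prod f f) (x, y) = {(f x, f y) | f. f \<in> K}"
  by (auto simp: orbit_def)

lemma orbitals_eq:
  "orbitals G M = {{(f x, f y) | f. f \<in> M} | x y. x \<in> carrier G \<and> y \<in> carrier G}"
  unfolding orbitals_def orbits_def by (auto simp: orbit_map_prod)

lemma in_own_orbital:
  assumes M: "subgroup M (Sym G)" and c: "x \<in> carrier G" "y \<in> carrier G"
  shows "(x, y) \<in> {(f x, f y) | f. f \<in> M}"
proof -
  have "(\<lambda>x \<in> carrier G. x) \<in> M"
    using subgroup.one_closed [OF M] by (simp add: BijGroup_def)
  then show ?thesis
    using c by (intro CollectI exI [of _ "\<lambda>x \<in> carrier G. x"]) simp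
qed

lemma orbital_eq:
  assumes M: "subgroup M (Sym G)" and c: "x \<in> carrier G" "y \<in> carrier G" and g: "g \<in> M"
  shows "{(f (g x), f (g y)) | f. f \<in> M} = {(f x, f y) | f. f \<in> M}"
proof -
  have gB: "g \<in> Bij (carrier G)"
    using subgroup.subset [OF M] g by (auto simp: BijGroup_def)
  define h where "h = inv\<^bsub>Sym G\<^esub> g"
  have h: "h \<in> M"
    using subgroup.m_inv_closed [OF M g] by (simp add: h_def)
  have hg: "h (g z) = z" if "z \<in> carrier G" for z
    using that gB
    by (simp add: h_def inv_BijGroup Bij_imp_funcset [THEN funcset_mem] Bij_def bij_betw_def)
  have comp: "compose (carrier G) a b \<in> M" if "a \<in> M" "b \<in> M" for a b
    using subgroup.m_closed [OF M that] subgroup.subset [OF M] that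
    by (auto simp: BijGroup_def subset_iff)
  have gc: "g x \<in> carrier G" "g y \<in> carrier G"
    using gB c Bij_imp_funcset by blast+
  show ?thesis
  proof (intro equalityI subsetI)
    fix p assume "p \<in> {(f (g x), f (g y)) | f. f \<in> M}"
    then obtain f where "f \<in> M" "p = (f (g x), f (g y))" by auto
    then show "p \<in> {(f x, f y) | f. f \<in> M}"
      using comp [of f g] g c
      by (intro CollectI exI [of _ "compose (carrier G) f g"]) (simp add: compose_eq)
  next
    fix p assume "p \<in> {(f x, f y) | f. f \<in> M}"
    then obtain f where "f \<in> M" "p = (f x, f y)" by auto
    then show "p \<in> {(f (g x), f (g y)) | f. f \<in> M}"
      using comp [of f h] h c hg gc
      by (intro CollectI exI [of _ "compose (carrier G) f h"]) (simp add: compose_eq)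
  qed
qed

lemma orbitals_eq_iff:
  assumes K: "subgroup K (Sym G)" and L: "subgroup L (Sym G)"
  shows "orbitals G L = orbitals G K \<longleftrightarrow>
    (\<forall>x \<in> carrier G. \<forall>y \<in> carrier G. {(f x, f y) | f. f \<in> L} = {(f x, f y) | f. f \<in> K})"
    (is "?lhs \<longleftrightarrow> ?rhs")
proof
  assume eq: ?lhs
  show ?rhs
  proof (intro ballI)
    fix x y assume c: "x \<in> carrier G" "y \<in> carrier G"
    have "{(f x, f y) | f. f \<in> L} \<in> orbitals G K"
      unfolding eq [symmetric] unfolding orbitals_eq using c by blast
    then obtain u v where uv: "u \<in> carrier G" "v \<in> carrier G"
      and e: "{(f x, f y) | f. f \<in> L} = {(f u, f v) | f. f \<in> K}"
      unfolding orbitals_eq mem_Collect_eq by (elim exE conjE)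
    have "(x, y) \<in> {(f u, f v) | f. f \<in> K}"
      using in_own_orbital [OF L c] unfolding e .
    then obtain g where g: "g \<in> K" "x = g u" "y = g v" by auto
    show "{(f x, f y) | f. f \<in> L} = {(f x, f y) | f. f \<in> K}"
      unfolding e unfolding g(2,3) by (rule orbital_eq [OF K uv g(1), symmetric])
  qed
next
  assume eq: ?rhs
  have "{{(f x, f y) | f. f \<in> L} | x y. x \<in> carrier G \<and> y \<in> carrier G} =
      (\<lambda>(x, y). {(f x, f y) | f. f \<in> L}) ` (carrier G \<times> carrier G)"
    by auto
  also have "\<dots> = (\<lambda>(x, y). {(f x, f y) | f. f \<in> K}) ` (carrier G \<times> carrier G)"
    by (rule image_cong [OF refl]) (use eq in fastforce)
  also have "\<dots> = {{(f x, f y) | f. f \<in> K} | x y. x \<in> carrier G \<and> y \<in> carrier G}"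
    by auto
  finally show ?lhs
    unfolding orbitals_eq .
qed

lemma
  assumes K: "subgroup K (Sym G)"
  defines "M \<equiv> {f \<in> Bij (carrier G).
    \<forall>x \<in> carrier G. \<forall>y \<in> carrier G. \<exists>k \<in> K. f x = k x \<and> f y = k y}"
  shows two_closure_greatest:
      "subgroup M (Sym G) \<and> orbitals G M = orbitals G K"
      "\<And>L. subgroup L (Sym G) \<Longrightarrow> orbitals G L = orbitals G K \<Longrightarrow> L \<subseteq> M"
    and two_closure_eq: "two_closure G K = M"
proof -
  have KB: "K \<subseteq> Bij (carrier G)"
    using subgroup.subset [OF K] by (simp add: BijGroup_def)
  have comp: "compose (carrier G) a b \<in> K" if "a \<in> K" "b \<in> K" for a b
    using subgroup.m_closed [OF K that] KB that by (auto simp: BijGroup_def subset_iff)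
  have inv: "(\<lambda>x \<in> carrier G. inv_into (carrier G) a x) \<in> K" if "a \<in> K" for a
    using subgroup.m_inv_closed [OF K that] KB that by (auto simp: inv_BijGroup subset_iff)
  have one: "(\<lambda>x \<in> carrier G. x) \<in> K"
    using subgroup.one_closed [OF K] by (simp add: BijGroup_def)
  have KM: "K \<subseteq> M" using KB by (auto simp: M_def)
  have sub: "subgroup M (Sym G)"
  proof (rule subgroup.intro)
    show "M \<subseteq> carrier (Sym G)" by (auto simp: M_def BijGroup_def)
    show "\<one>\<^bsub>Sym G\<^esub> \<in> M" using one KM by (auto simp: BijGroup_def)
  next
    fix f g assume f: "f \<in> M" and g: "g \<in> M"
    have B: "f \<in> Bij (carrier G)" "g \<in> Bij (carrier G)" using f g by (auto simp: M_def)
    have "\<exists>k \<in> K. f (g x) = k x \<and> f (g y) = k y" if c: "x \<in> carrier G" "y \<in> carrier G" for x y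
    proof -
      obtain b where b: "b \<in> K" "g x = b x" "g y = b y" using g c by (auto simp: M_def)
      have "g x \<in> carrier G" "g y \<in> carrier G"
        using B(2) c Bij_imp_funcset by blast+
      then obtain a where a: "a \<in> K" "f (g x) = a (g x)" "f (g y) = a (g y)"
        using f unfolding M_def by blast
      show ?thesis
        using comp [OF a(1) b(1)] a b c
        by (intro bexI [of _ "compose (carrier G) a b"]) (auto simp: compose_def)
    qed
    then show "f \<otimes>\<^bsub>Sym G\<^esub> g \<in> M"
      using B by (auto simp: BijGroup_def M_def compose_Bij compose_def [of "carrier G" f g]
        intro: compose_Bij [unfolded compose_def])
  next
    fix f assume f: "f \<in> M"
    then have B: "f \<in> Bij (carrier G)" by (auto simp: M_def)
    let ?f = "inv_into (carrier G) f"
    have "\<exists>k \<in> K. ?f x = k x \<and> ?f y = k y" if c: "x \<in> carrier G" "y \<in> carrier G" for x y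
    proof -
      have i: "?f x \<in> carrier G" "?f y \<in> carrier G" "f (?f x) = x" "f (?f y) = y"
        using B c Bij_inv_into_mem [OF B] by (auto simp: Bij_def bij_betw_def f_inv_into_f)
      have "\<exists>a \<in> K. f (?f x) = a (?f x) \<and> f (?f y) = a (?f y)"
        using f i(1,2) unfolding M_def by blast
      then obtain a where a: "a \<in> K" "a (?f x) = x" "a (?f y) = y"
        using i(3,4) by auto
      have "inj_on a (carrier G)" using KB a(1) by (auto simp: Bij_def bij_betw_def)
      then have "inv_into (carrier G) a x = ?f x" "inv_into (carrier G) a y = ?f y"
        using a i by (metis inv_into_f_f)+
      then show ?thesis
        using inv [OF a(1)] c by (intro bexI [of _ "restrict (inv_into (carrier G) a) (carrier G)"]) auto
    qed
    then show "inv\<^bsub>Sym G\<^esub> f \<in> M"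
      using restrict_inv_into_Bij [OF B] by (auto simp: inv_BijGroup [OF B] M_def)
  qed
  have orb: "orbitals G M = orbitals G K"
    unfolding orbitals_eq_iff [OF K sub]
  proof (intro ballI equalityI subsetI)
    fix x y p assume "x \<in> carrier G" "y \<in> carrier G" "p \<in> {(f x, f y) | f. f \<in> M}"
    then show "p \<in> {(f x, f y) | f. f \<in> K}" unfolding M_def by fastforce
  next
    fix x y p assume "x \<in> carrier G" "y \<in> carrier G" "p \<in> {(f x, f y) | f. f \<in> K}"
    then show "p \<in> {(f x, f y) | f. f \<in> M}" using KM by blast
  qed
  show 1: "subgroup M (Sym G) \<and> orbitals G M = orbitals G K"
    using sub orb by simp
  show 2: "L \<subseteq> M" if L: "subgroup L (Sym G)" and "orbitals G L = orbitals G K" for L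
  proof
    fix f assume f: "f \<in> L"
    have "f \<in> Bij (carrier G)" using subgroup.subset [OF L] f by (auto simp: BijGroup_def)
    moreover have "\<exists>k \<in> K. f x = k x \<and> f y = k y" if "x \<in> carrier G" "y \<in> carrier G" for x y
    proof -
      have "(f x, f y) \<in> {(f x, f y) | f. f \<in> K}"
        using f that \<open>orbitals G L = orbitals G K\<close> unfolding orbitals_eq_iff [OF K L] by blast
      then show ?thesis by auto
    qed
    ultimately show "f \<in> M" by (auto simp: M_def)
  qed
  show "two_closure G K = M"
    unfolding two_closure_def by (rule Greatest_equality) (use 1 2 in auto)
qed

end

theory Submission
  imports Defs
begin

text \<open>
  Let \<open>K\<close> lie between \<open>G\<^sub>r\<close> and \<open>Hol(G)\<close>. Then \<open>G\<^sub>r\<close> is normal in \<open>K\<close>, so \<open>K\<close> is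
  \<open>G\<close>-transjugate exactly if \<open>G\<^sub>r\<close> is its only \<open>G\<close>-regular subgroup. A regular abelian subgroup
  \<open>R\<close> of the holomorph of an abelian group \<open>G\<close> is given by a commutative, associative,
  biadditive product on \<open>G\<close>: with \<open>G\<close> written additively, as in all comments below, \<open>R\<close> consists
  of the maps \<open>x \<mapsto> a + x + a x\<close>, and \<open>R = G\<^sub>r\<close> exactly if the product is zero
  (\<open>regular_abelian_in_holomorph\<close>). The 2-closure of \<open>\<langle>G\<^sub>r, R\<rangle>\<close> is the set of all
  permutations \<open>f\<close> with \<open>f x - f y \<in> (x - y) + (x - y) G\<close>. The theorem therefore asks for which
  groups \<open>G\<close> every nonzero product with \<open>R \<cong> G\<close> admits such an \<open>f\<close> that is not affine.

  \<^bold>\<open>Sufficiency.\<close> Let \<open>G\<close> be elementary abelian with a nonzero product coming from an \<open>R\<close> that is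
  again elementary abelian, which means \<open>x x = 0\<close> for all \<open>x\<close>. Suppose that \<open>z a \<noteq> 0\<close> and that
  \<open>z G \<subseteq> t G\<close> for every \<open>t\<close> with \<open>t a \<noteq> 0\<close>. Put \<open>f u = u\<close> if \<open>u a = 0\<close> and \<open>f u = u + u z\<close>
  otherwise. Then \<open>f\<close> lies in the 2-closure and is not affine, because \<open>f (z + a) \<noteq> f z + f a\<close>
  (\<open>two_closed_not_in_holomorph\<close>). Such a pair exists as soon as \<open>G\<close> has at most 32 elements
  (\<open>exists_absorbing_pair\<close>); this is where the bound 5 on the rank comes from. For \<open>C\<^sub>4\<close> the
  holomorph contains no other regular cyclic subgroup at all (\<open>NCI2_group_if_cyclic_four\<close>).

  \<^bold>\<open>Necessity.\<close> A map \<open>q\<close> on \<open>G\<close> whose polarisation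
  \<open>\<beta> x y = q (x + y) - q x - q y\<close> is biadditive and nonzero, and which satisfies
  \<open>q (x + q y) = q x\<close>, gives the product \<open>\<beta>\<close>. The permutation \<open>x \<mapsto> x + q x\<close> conjugates \<open>G\<^sub>r\<close> to
  the corresponding \<open>R\<close>, so \<open>R\<close> is \<open>G\<close>-regular. If moreover every \<open>g\<close> with \<open>g 0 = 0\<close> and
  \<open>g x - g y \<in> \<beta> (x - y) G\<close> is additive, then the 2-closure stays inside the holomorph, and \<open>G\<close>
  fails to have the property (\<open>not_NCI2_group_if_quadratic_map\<close>). There are two sources of such \<open>q\<close>.
  If \<open>G\<close> has an epimorphism \<open>\<chi>\<close> onto \<open>C\<^sub>4\<close> and an involution \<open>w\<close> in its kernel, let \<open>q x\<close> be \<open>w\<close>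
  or \<open>0\<close> according to whether \<open>\<chi> x \<in> {2, 3}\<close>. An abelian 2-group that is not
  elementary always has such a \<open>\<chi>\<close>, and its kernel contains an involution unless \<open>\<chi>\<close> is an
  isomorphism. If \<open>G\<close> is \<open>C\<^sub>2\<^sup>k\<close> with \<open>k \<ge> 6\<close>, then three coordinates and three further basis vectors
  allow \<open>\<beta>\<close> to be the cross product on a three-dimensional space, and the orthogonality of \<open>u \<times> v\<close> to
  \<open>u\<close> forces additivity (\<open>not_NCI2_group_if_six_coordinates\<close>).
\<close>

section \<open>The holomorph and its regular subgroups\<close>

lemma Sym_mult:
  assumes "f \<in> Bij S" "g \<in> Bij S"
  shows "f \<otimes>\<^bsub>BijGroup S\<^esub> g = compose S f g"
  using assms by (simp add: BijGroup_def)

lemma (in group) conjugate_eq_iff_cosets_eq: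
  assumes "H \<subseteq> carrier G" "g \<in> carrier G"
  shows "g <# H #> inv g = H \<longleftrightarrow> g <# H = H #> g"
proof -
  have gH: "g <# H \<subseteq> carrier G" using assms by (rule l_coset_subset_G)
  have "(g <# H #> inv g) #> g = g <# H"
    using gH assms by (simp add: coset_mult_assoc coset_mult_one)
  moreover have "(H #> g) #> inv g = H"
    using assms by (simp add: coset_mult_assoc coset_mult_one)
  ultimately show ?thesis by metis
qed

context comm_group
begin

definition translation :: "'a \<Rightarrow> 'a \<Rightarrow> 'a"
  where "translation a = (\<lambda>x \<in> carrier G. x \<otimes> a)"

lemma right_translations_eq: "right_translations G = translation ` carrier G"
  by (auto simp: right_translations_def translation_def)

lemma translation_Bij: "a \<in> carrier G \<Longrightarrow> translation a \<in> Bij (carrier G)"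
  unfolding translation_def Bij_def
  by (auto intro!: bij_betw_byWitness [where f' = "\<lambda>x. x \<otimes> inv a"] simp: m_assoc)

lemma right_translations_subset: "right_translations G \<subseteq> carrier (Sym G)"
  using translation_Bij by (auto simp: right_translations_eq BijGroup_def)

lemma Sym_group: "group (Sym G)"
  by (rule group_BijGroup)

lemma Bij_closed: "f \<in> Bij (carrier G) \<Longrightarrow> x \<in> carrier G \<Longrightarrow> f x \<in> carrier G"
  using Bij_imp_funcset by blast

lemma holomorph_conjugation:
  "f \<in> holomorph G \<longleftrightarrow>
    f \<in> Bij (carrier G) \<and>
    f <#\<^bsub>Sym G\<^esub> right_translations G #>\<^bsub>Sym G\<^esub> inv\<^bsub>Sym G\<^esub> f = right_translations G"
  using right_translations_subset
  by (auto simp: holomorph_def normalizer_def stabilizer_def BijGroup_def [of "carrier G"])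

text \<open>
  An element \<open>f\<close> of the holomorph is an automorphism followed by a translation. The identity is the
  division-free form of the statement that \<open>x \<mapsto> f x - f 0\<close> is additive.
\<close>

lemma holomorph_iff:
  "f \<in> holomorph G \<longleftrightarrow>
    f \<in> Bij (carrier G) \<and>
    (\<forall>x \<in> carrier G. \<forall>y \<in> carrier G. f (x \<otimes> y) \<otimes> f \<one> = f x \<otimes> f y)"
proof (cases "f \<in> Bij (carrier G)")
  case True
  note f = Bij_closed [OF True]
  have carr: "carrier (Sym G) = Bij (carrier G)" by (simp add: BijGroup_def)
  have "f <#\<^bsub>Sym G\<^esub> right_translations G = (\<lambda>a. compose (carrier G) f (translation a)) ` carrier G"
    using True by (auto simp: l_coset_def right_translations_eq Sym_mult translation_Bij)
  moreover have "right_translations G #>\<^bsub>Sym G\<^esub> f = (\<lambda>b. compose (carrier G) (translation b) f) ` carrier G"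
    using True by (auto simp: r_coset_def right_translations_eq Sym_mult translation_Bij)
  moreover have "f \<in> holomorph G \<longleftrightarrow>
      f <#\<^bsub>Sym G\<^esub> right_translations G = right_translations G #>\<^bsub>Sym G\<^esub> f"
    using True group.conjugate_eq_iff_cosets_eq [OF Sym_group right_translations_subset] carr
    by (simp add: holomorph_conjugation)
  ultimately have "f \<in> holomorph G \<longleftrightarrow>
      (\<lambda>a. compose (carrier G) f (translation a)) ` carrier G =
      (\<lambda>b. compose (carrier G) (translation b) f) ` carrier G" (is "_ \<longleftrightarrow> ?A = ?B")
    by simp
  also have "\<dots> \<longleftrightarrow> (\<forall>x \<in> carrier G. \<forall>y \<in> carrier G. f (x \<otimes> y) \<otimes> f \<one> = f x \<otimes> f y)"
  proof
    assume eq: "?A = ?B"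
    show "\<forall>x \<in> carrier G. \<forall>y \<in> carrier G. f (x \<otimes> y) \<otimes> f \<one> = f x \<otimes> f y"
    proof (intro ballI)
      fix x y assume c: "x \<in> carrier G" "y \<in> carrier G"
      have "compose (carrier G) f (translation y) \<in> ?B" using eq c by blast
      then obtain b where b: "b \<in> carrier G"
        and e: "compose (carrier G) f (translation y) = compose (carrier G) (translation b) f" by blast
      have fb: "f (z \<otimes> y) = f z \<otimes> b" if "z \<in> carrier G" for z
        using fun_cong [OF e, of z] that f by (simp add: compose_def translation_def)
      show "f (x \<otimes> y) \<otimes> f \<one> = f x \<otimes> f y"
        using fb [of x] fb [of \<one>] c b f by (simp add: m_ac)
    qed
  next
    assume aff: "\<forall>x \<in> carrier G. \<forall>y \<in> carrier G. f (x \<otimes> y) \<otimes> f \<one> = f x \<otimes> f y"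
    have tr: "compose (carrier G) f (translation y) = compose (carrier G) (translation (f y \<otimes> inv (f \<one>))) f"
      if "y \<in> carrier G" for y
    proof
      fix z
      show "compose (carrier G) f (translation y) z = compose (carrier G) (translation (f y \<otimes> inv (f \<one>))) f z"
      proof (cases "z \<in> carrier G")
        case z: True
        have "f (z \<otimes> y) = f z \<otimes> f y \<otimes> inv (f \<one>)"
          using aff z that f by (metis inv_solve_right m_closed one_closed)
        then show ?thesis using z that f by (simp add: compose_def translation_def m_assoc)
      qed (simp add: compose_def)
    qed
    show "?A = ?B"
    proof (intro equalityI subsetI)
      fix p assume "p \<in> ?A"
      then show "p \<in> ?B" using tr f by auto
    next
      fix p assume "p \<in> ?B"
      then obtain b where b: "b \<in> carrier G" "p = compose (carrier G) (translation b) f" by blast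
      have "b \<otimes> f \<one> \<in> f ` carrier G" using True b f by (simp add: Bij_def bij_betw_def)
      then obtain y where y: "y \<in> carrier G" "f y = b \<otimes> f \<one>" by auto
      then have "f y \<otimes> inv (f \<one>) = b" using b f by (simp add: m_assoc)
      then show "p \<in> ?A" using tr [OF y(1)] b y by (metis imageI)
    qed
  qed
  finally show ?thesis using True by simp
qed (simp add: holomorph_conjugation)

text \<open>
  Elements of the holomorph normalise the group of right translations, so its only conjugate inside
  \<open>K\<close> is itself.
\<close>

lemma transjugate_in_holomorph_iff:
  assumes "subgroup K (Sym G)" "right_translations G \<subseteq> K" "K \<subseteq> holomorph G"
  shows "G_transjugate G K \<longleftrightarrow> (\<forall>R. G_regular G R \<and> R \<subseteq> K \<longrightarrow> R = right_translations G)"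
proof -
  have "k <#\<^bsub>Sym G\<^esub> right_translations G #>\<^bsub>Sym G\<^esub> inv\<^bsub>Sym G\<^esub> k = right_translations G"
    if "k \<in> K" for k
    using that assms holomorph_conjugation by blast
  moreover have "K \<noteq> {}" using subgroup.one_closed [OF assms(1)] by blast
  ultimately show ?thesis unfolding G_transjugate_def using assms by auto
qed

lemma regular_on_subgroup_iff:
  assumes R: "subgroup R (BijGroup S)"
  shows "regular_on S R \<longleftrightarrow>
    (\<forall>x \<in> S. \<forall>y \<in> S. \<exists>f \<in> R. f x = y) \<and>
    (\<forall>f \<in> R. \<forall>x \<in> S. f x = x \<longrightarrow> f = (\<lambda>x \<in> S. x))" (is "_ \<longleftrightarrow> ?tr \<and> ?fr")
proof -
  have one: "(\<lambda>x \<in> S. x) \<in> R"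
    using subgroup.one_closed [OF R] by (simp add: BijGroup_def)
  have "group_hom ((BijGroup S)\<lparr>carrier := R\<rparr>) (BijGroup S) (\<lambda>f. f)"
    using subgroup.subgroup_is_group [OF R group_BijGroup] group_BijGroup subgroup.subset [OF R]
    by (auto simp: group_hom_def group_hom_axioms_def hom_def)
  then have "transitive_action ((BijGroup S)\<lparr>carrier := R\<rparr>) S (\<lambda>f. f) \<longleftrightarrow> ?tr"
    by (auto simp: transitive_action_def transitive_action_axioms_def group_action_def)
  moreover have "(\<forall>x \<in> S. stabilizer ((BijGroup S)\<lparr>carrier := R\<rparr>) (\<lambda>f. f) x = {\<one>\<^bsub>BijGroup S\<^esub>}) \<longleftrightarrow> ?fr"
    using one by (auto simp: stabilizer_def BijGroup_def)
  ultimately show ?thesis by (simp add: regular_on_def)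
qed

end

section \<open>Regular subgroups of the holomorph as ring structures\<close>

lemma exponent_two_iso:
  assumes "group G" "group H" "G \<cong> H" "\<And>x. x \<in> carrier G \<Longrightarrow> x \<otimes>\<^bsub>G\<^esub> x = \<one>\<^bsub>G\<^esub>"
    and y: "y \<in> carrier H"
  shows "y \<otimes>\<^bsub>H\<^esub> y = \<one>\<^bsub>H\<^esub>"
proof -
  obtain h where h: "h \<in> iso G H" using assms(3) by (auto simp: is_iso_def)
  then obtain x where x: "x \<in> carrier G" "y = h x"
    using y by (auto simp: iso_def bij_betw_def)
  have hom: "h \<in> hom G H" using h by (simp add: iso_def)
  then have "y \<otimes>\<^bsub>H\<^esub> y = h (x \<otimes>\<^bsub>G\<^esub> x)" using x by (simp add: hom_mult)
  then show ?thesis using assms(4) [OF x(1)] hom_one [OF hom assms(1,2)] by simp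
qed

text \<open>
  A ring structure whose additive group is \<open>G\<close>: the operation \<open>\<otimes>\<close> of \<open>G\<close> plays the role of
  addition, \<open>\<one>\<close> that of zero, and \<open>\<star>\<close> that of multiplication.
\<close>

locale group_product = comm_group G for G (structure) +
  fixes prd :: "'a \<Rightarrow> 'a \<Rightarrow> 'a"  (infixl "\<star>" 75)
  assumes prd_closed [simp, intro]: "\<lbrakk>x \<in> carrier G; y \<in> carrier G\<rbrakk> \<Longrightarrow> x \<star> y \<in> carrier G"
    and prd_comm: "\<lbrakk>x \<in> carrier G; y \<in> carrier G\<rbrakk> \<Longrightarrow> x \<star> y = y \<star> x"
    and prd_assoc: "\<lbrakk>x \<in> carrier G; y \<in> carrier G; z \<in> carrier G\<rbrakk> \<Longrightarrow> (x \<star> y) \<star> z = x \<star> (y \<star> z)"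
    and prd_distr: "\<lbrakk>x \<in> carrier G; y \<in> carrier G; z \<in> carrier G\<rbrakk> \<Longrightarrow>
      x \<star> (y \<otimes> z) = (x \<star> y) \<otimes> (x \<star> z)"
begin

lemma prd_distr2: "\<lbrakk>x \<in> carrier G; y \<in> carrier G; z \<in> carrier G\<rbrakk> \<Longrightarrow>
      (x \<otimes> y) \<star> z = (x \<star> z) \<otimes> (y \<star> z)"
  by (simp add: prd_comm [of _ z] prd_distr)

lemma prd_one [simp]: assumes "x \<in> carrier G" shows "x \<star> \<one> = \<one>"  "\<one> \<star> x = \<one>"
proof -
  show "x \<star> \<one> = \<one>"
    using prd_distr [of x \<one> \<one>] assms by (metis l_cancel_one one_closed prd_closed r_one)
  then show "\<one> \<star> x = \<one>" using assms prd_comm by simp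
qed

text \<open>
  The translation by \<open>a\<close> with respect to the circle operation \<open>a + x + a x\<close> of the ring.
\<close>

definition circle_translation :: "'a \<Rightarrow> 'a \<Rightarrow> 'a"
  where "circle_translation a = (\<lambda>x \<in> carrier G. a \<otimes> x \<otimes> (a \<star> x))"

lemma circle_translation_closed:
  "\<lbrakk>a \<in> carrier G; x \<in> carrier G\<rbrakk> \<Longrightarrow> circle_translation a x \<in> carrier G"
  by (simp add: circle_translation_def)

lemma compose_circle_translation:
  assumes "a \<in> carrier G" "b \<in> carrier G"
  shows "compose (carrier G) (circle_translation a) (circle_translation b) =
    circle_translation (a \<otimes> b \<otimes> (a \<star> b))"
  using assms by (auto simp: compose_def circle_translation_def prd_distr prd_distr2 prd_assoc m_ac)

lemma circle_translation_one: "circle_translation \<one> = \<one>\<^bsub>Sym G\<^esub>"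
  by (auto simp: circle_translation_def BijGroup_def)

lemma circle_translations_trivial:
  assumes "\<And>x y. \<lbrakk>x \<in> carrier G; y \<in> carrier G\<rbrakk> \<Longrightarrow> x \<star> y = \<one>"
  shows "circle_translation ` carrier G = right_translations G"
proof -
  have "circle_translation a = translation a" if "a \<in> carrier G" for a
    using that assms by (auto simp: circle_translation_def translation_def m_comm)
  then show ?thesis by (simp add: right_translations_eq)
qed

text \<open>
  The group of circle translations has exponent two exactly if \<open>2 a + a a = 0\<close> for all \<open>a\<close>. This is how
  the isomorphism type of a regular subgroup restricts the product.
\<close>

lemma circle_square:
  assumes Bij: "circle_translation ` carrier G \<subseteq> Bij (carrier G)" and a: "a \<in> carrier G"
  shows "circle_translation a \<otimes>\<^bsub>Sym G\<^esub> circle_translation a = \<one>\<^bsub>Sym G\<^esub> \<longleftrightarrow>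
    a \<otimes> a \<otimes> (a \<star> a) = \<one>"
proof -
  have eq: "circle_translation a \<otimes>\<^bsub>Sym G\<^esub> circle_translation a = circle_translation (a \<otimes> a \<otimes> (a \<star> a))"
    using assms by (simp add: Sym_mult compose_circle_translation image_subset_iff)
  show ?thesis
  proof
    assume "circle_translation a \<otimes>\<^bsub>Sym G\<^esub> circle_translation a = \<one>\<^bsub>Sym G\<^esub>"
    then have "circle_translation (a \<otimes> a \<otimes> (a \<star> a)) = circle_translation \<one>"
      by (simp add: eq circle_translation_one)
    from fun_cong [OF this, of \<one>] show "a \<otimes> a \<otimes> (a \<star> a) = \<one>"
      using a by (simp add: circle_translation_def)
  qed (simp add: eq circle_translation_one)
qed

end

text \<open>
  Regularity indexes \<open>R\<close> by \<open>G\<close>: let \<open>\<rho> a\<close> be the element that maps \<open>0\<close> to \<open>a\<close>, and put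
  \<open>a x = \<rho> a x - a - x\<close>. Each axiom of the product reflects one property of \<open>R\<close>. Since
  \<open>\<rho> a x = \<rho> a (\<rho> x 0)\<close>, the product commutes because \<open>R\<close> does; it is additive in \<open>x\<close> because
  \<open>\<rho> a\<close> is affine; and it is associative because \<open>\<rho> a (\<rho> b x) = \<rho> (\<rho> a b) x\<close>.
\<close>

lemma (in comm_group) regular_abelian_in_holomorph:
  assumes R: "subgroup R (Sym G)" "R \<subseteq> holomorph G" "regular_on (carrier G) R"
    and comm: "\<And>f g. \<lbrakk>f \<in> R; g \<in> R\<rbrakk> \<Longrightarrow> compose (carrier G) f g = compose (carrier G) g f"
  obtains prd where "group_product G prd" "R = group_product.circle_translation G prd ` carrier G"
proof -
  have RB: "R \<subseteq> Bij (carrier G)" using R(2) holomorph_iff by blast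
  have tr: "\<exists>f \<in> R. f \<one> = a" if "a \<in> carrier G" for a
    using that R regular_on_subgroup_iff by blast
  have comp: "compose (carrier G) f g \<in> R" if "f \<in> R" "g \<in> R" for f g
    using subgroup.m_closed [OF R(1) that] RB that by (simp add: Sym_mult subset_iff)
  have eqI: "f = g" if fg: "f \<in> R" "g \<in> R" "f \<one> = g \<one>" for f g
  proof -
    \<comment> \<open>This element fixes the identity of \<open>G\<close>, so it is trivial by regularity.\<close>
    let ?k = "inv\<^bsub>Sym G\<^esub> g \<otimes>\<^bsub>Sym G\<^esub> f"
    have kR: "?k \<in> R" using fg R(1) by (simp add: subgroup.m_closed subgroup.m_inv_closed)
    have B: "f \<in> Bij (carrier G)" "g \<in> Bij (carrier G)" using fg RB by auto
    have "?k \<one> = inv_into (carrier G) g (g \<one>)"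
      using B fg(3) by (simp add: inv_BijGroup Sym_mult restrict_inv_into_Bij compose_def Bij_closed)
    also have "\<dots> = \<one>" using B by (simp add: Bij_def bij_betw_def)
    finally have "?k = (\<lambda>x \<in> carrier G. x)"
      using kR R(1,3) regular_on_subgroup_iff [OF R(1)] by auto
    then have "?k = \<one>\<^bsub>Sym G\<^esub>" by (simp add: BijGroup_def)
    moreover have "f \<in> carrier (Sym G)" "g \<in> carrier (Sym G)" using B by (auto simp: BijGroup_def)
    ultimately show ?thesis
      using group.inv_equality Sym_group group.inv_inv group.inv_closed by metis
  qed
  define \<rho> where "\<rho> a = (SOME f. f \<in> R \<and> f \<one> = a)" for a
  have \<rho>: "\<rho> a \<in> R" "\<rho> a \<one> = a" if "a \<in> carrier G" for a
    using someI_ex [of "\<lambda>f. f \<in> R \<and> f \<one> = a"] tr [OF that] unfolding \<rho>_def by blast+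
  have \<rho>c [simp]: "\<rho> a x \<in> carrier G" if "a \<in> carrier G" "x \<in> carrier G" for a x
    using \<rho> that RB Bij_closed by blast
  \<comment> \<open>In additive notation this is \<open>\<rho> a x - a - x\<close>.\<close>
  define prd where "prd a x = inv a \<otimes> inv x \<otimes> \<rho> a x" for a x
  have pc [simp]: "prd a x \<in> carrier G" if "a \<in> carrier G" "x \<in> carrier G" for a x
    using that by (simp add: prd_def)
  have \<rho>eq: "\<rho> a x = a \<otimes> x \<otimes> prd a x" if "a \<in> carrier G" "x \<in> carrier G" for a x
  proof -
    have "a \<otimes> x \<otimes> (inv a \<otimes> inv x \<otimes> \<rho> a x) = (a \<otimes> inv a) \<otimes> (x \<otimes> inv x) \<otimes> \<rho> a x"
      using that by (simp add: m_ac del: r_inv Units_r_inv)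
    then show ?thesis using that by (simp add: prd_def)
  qed
  have \<rho>\<rho>: "\<rho> a (\<rho> b x) = \<rho> (\<rho> a b) x" if "a \<in> carrier G" "b \<in> carrier G" "x \<in> carrier G" for a b x
  proof -
    have "compose (carrier G) (\<rho> a) (\<rho> b) = \<rho> (\<rho> a b)"
      using that \<rho> comp by (intro eqI) (auto simp: compose_def)
    then show ?thesis using that by (metis compose_eq)
  qed
  have sym: "\<rho> a x = \<rho> x a" if "a \<in> carrier G" "x \<in> carrier G" for a x
    using comm [OF \<rho>(1) \<rho>(1), of a x] that \<rho>(2)
    by (metis compose_eq one_closed)
  have "group_product G prd"
  proof
    show "prd x y \<in> carrier G" if "x \<in> carrier G" "y \<in> carrier G" for x y
      using that by simp
    show "prd x y = prd y x" if "x \<in> carrier G" "y \<in> carrier G" for x y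
      using that sym [OF that] by (simp add: prd_def m_ac)
    show distr: "prd x (y \<otimes> z) = prd x y \<otimes> prd x z"
      if c: "x \<in> carrier G" "y \<in> carrier G" "z \<in> carrier G" for x y z
    proof -
      have "\<rho> x (y \<otimes> z) \<otimes> x = \<rho> x y \<otimes> \<rho> x z"
        using \<rho> [OF c(1)] R(2) c holomorph_iff by (metis subsetD)
      then have "(x \<otimes> x \<otimes> y \<otimes> z) \<otimes> prd x (y \<otimes> z) = (x \<otimes> x \<otimes> y \<otimes> z) \<otimes> (prd x y \<otimes> prd x z)"
        using c by (simp add: \<rho>eq m_ac)
      then show ?thesis using c by (meson l_cancel m_closed pc)
    qed
    fix x y z assume c: "x \<in> carrier G" "y \<in> carrier G" "z \<in> carrier G"
    have distr2: "prd (u \<otimes> v) w = prd u w \<otimes> prd v w"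
      if "u \<in> carrier G" "v \<in> carrier G" "w \<in> carrier G" for u v w
      using that sym distr by (simp add: prd_def m_ac)
    have "(x \<otimes> y \<otimes> z \<otimes> prd x y \<otimes> prd x z \<otimes> prd y z) \<otimes> prd (prd x y) z =
          (x \<otimes> y \<otimes> z \<otimes> prd x y \<otimes> prd x z \<otimes> prd y z) \<otimes> prd x (prd y z)"
      using \<rho>\<rho> [OF c] c by (simp add: \<rho>eq distr distr2 m_ac)
    then show "prd (prd x y) z = prd x (prd y z)"
      using c by (meson l_cancel m_closed pc)
  qed
  then interpret P: group_product G prd .
  have "P.circle_translation a = \<rho> a" if "a \<in> carrier G" for a
  proof (rule extensionalityI [of _ "carrier G"])
    show "\<rho> a \<in> extensional (carrier G)" using that \<rho> RB Bij_imp_extensional by blast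
  qed (use that in \<open>auto simp: P.circle_translation_def \<rho>eq\<close>)
  moreover have "\<rho> ` carrier G = R"
  proof (intro equalityI subsetI)
    fix f assume f: "f \<in> R"
    then have "f \<one> \<in> carrier G" using RB Bij_closed by blast
    then show "f \<in> \<rho> ` carrier G" using f eqI \<rho> by (metis imageI)
  qed (use \<rho> in auto)
  ultimately have "R = P.circle_translation ` carrier G" by simp
  with \<open>group_product G prd\<close> that show thesis by blast
qed

context comm_group
begin

lemma group_subgroup_Sym: "subgroup R (Sym G) \<Longrightarrow> group ((Sym G)\<lparr>carrier := R\<rparr>)"
  by (rule group.subgroup_imp_group [OF Sym_group])

lemma G_regular_in_holomorph_product:
  assumes R: "G_regular G R" "R \<subseteq> holomorph G"
  obtains prd where "group_product G prd" "R = group_product.circle_translation G prd ` carrier G"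
proof -
  have sub: "subgroup R (Sym G)" and reg: "regular_on (carrier G) R"
    and iso: "(Sym G)\<lparr>carrier := R\<rparr> \<cong> G"
    using R(1) by (auto simp: G_regular_def)
  have "G \<cong> (Sym G)\<lparr>carrier := R\<rparr>" using iso group.iso_sym group_subgroup_Sym [OF sub] by blast
  then have "comm_group ((Sym G)\<lparr>carrier := R\<rparr>)"
    using iso_imp_comm_group group_subgroup_Sym [OF sub] group.is_monoid by blast
  then have "f \<otimes>\<^bsub>Sym G\<^esub> g = g \<otimes>\<^bsub>Sym G\<^esub> f" if "f \<in> R" "g \<in> R" for f g
    using comm_monoid.m_comm [of "(Sym G)\<lparr>carrier := R\<rparr>" f g] that by (simp add: comm_group_def)
  moreover have "f \<in> Bij (carrier G)" if "f \<in> R" for f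
    using R(2) that holomorph_iff by blast
  ultimately have "compose (carrier G) f g = compose (carrier G) g f" if "f \<in> R" "g \<in> R" for f g
    using that by (metis Sym_mult)
  from regular_abelian_in_holomorph [OF sub R(2) reg this] that show thesis by blast
qed

end

section \<open>Elementary abelian groups of order at most 32\<close>

text \<open>
  A finite commutative algebra over the field with two elements in which every square vanishes.
\<close>

locale square_zero_product = group_product +
  assumes finite_carrier: "finite (carrier G)"
    and exponent_two [simp]: "x \<in> carrier G \<Longrightarrow> x \<otimes> x = \<one>"
    and square_zero [simp]: "x \<in> carrier G \<Longrightarrow> x \<star> x = \<one>"
begin

definition multiples :: "'a \<Rightarrow> 'a set"
  where "multiples z = (\<lambda>x. z \<star> x) ` carrier G"

definition annihilator :: "'a \<Rightarrow> 'a set"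
  where "annihilator z = {x \<in> carrier G. z \<star> x = \<one>}"

lemma cancel_twice [simp]: "\<lbrakk>x \<in> carrier G; y \<in> carrier G\<rbrakk> \<Longrightarrow> x \<otimes> (x \<otimes> y) = y"
  by (metis exponent_two l_one m_assoc)

lemma eq_iff_product_one: "\<lbrakk>x \<in> carrier G; y \<in> carrier G\<rbrakk> \<Longrightarrow> x \<otimes> y = \<one> \<longleftrightarrow> x = y"
  by (metis cancel_twice exponent_two r_one)

lemma prd_twice [simp]:
  assumes "x \<in> carrier G" "y \<in> carrier G"
  shows "x \<star> y \<star> y = \<one>" "x \<star> (x \<star> y) = \<one>" "y \<star> x \<star> y = \<one>"
proof -
  show "x \<star> y \<star> y = \<one>" using assms by (simp add: prd_assoc)
  then show "y \<star> x \<star> y = \<one>" using assms by (simp add: prd_comm [of y x])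
  have "x \<star> x \<star> y = \<one>" using assms by simp
  then show "x \<star> (x \<star> y) = \<one>" using assms by (simp only: prd_assoc)
qed

text \<open>
  A form of nilpotency: if \<open>x = x y\<close>, then \<open>x = x y y = 0\<close>.
\<close>

lemma eq_own_multiple: "\<lbrakk>x \<in> carrier G; y \<in> carrier G; x = x \<star> y\<rbrakk> \<Longrightarrow> x = \<one>"
  by (metis prd_twice(1))

lemma card_annihilator:
  assumes z: "z \<in> carrier G"
  shows "order G = card (multiples z) * card (annihilator z)"
proof -
  have "group_hom G (G\<lparr>carrier := multiples z\<rparr>) (\<lambda>x. z \<star> x)"
  proof -
    have "(\<lambda>x. z \<star> x) \<in> hom G G" using z by (auto simp: hom_def prd_distr)
    then have "group_hom G G (\<lambda>x. z \<star> x)" by (simp add: group_hom_def group_hom_axioms_def)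
    then have "subgroup (multiples z) G" unfolding multiples_def by (rule group_hom.img_is_subgroup)
    then have "group (G\<lparr>carrier := multiples z\<rparr>)" by (rule subgroup_imp_group)
    with z show ?thesis by (auto simp: group_hom_def group_hom_axioms_def hom_def multiples_def prd_distr)
  qed
  then interpret h: group_hom G "G\<lparr>carrier := multiples z\<rparr>" "\<lambda>x. z \<star> x" .
  let ?K = "kernel G (G\<lparr>carrier := multiples z\<rparr>) (\<lambda>x. z \<star> x)"
  have "card (carrier (G Mod ?K)) = card (multiples z)"
    using iso_same_card [OF h.FactGroup_iso] by (simp add: multiples_def)
  moreover have "?K = annihilator z" by (auto simp: kernel_def annihilator_def)
  ultimately show ?thesis
    using lagrange [OF h.subgroup_kernel] by (simp add: FactGroup_def)
qed

lemma annihilator_contains: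
  assumes z: "z \<in> carrier G"
  shows "multiples z \<union> (\<lambda>w. z \<otimes> w) ` multiples z \<subseteq> annihilator z"
  using z by (auto simp: multiples_def annihilator_def prd_distr)

text \<open>
  Nilpotency keeps \<open>z\<close> out of \<open>z G\<close>, so \<open>z G\<close> and its coset \<open>z + z G\<close> are disjoint. Both annihilate \<open>z\<close>,
  hence the annihilator of \<open>z\<close> has at least twice as many elements as \<open>z G\<close>.
\<close>

lemma card_multiples_and_shift:
  assumes z: "z \<in> carrier G" "z \<noteq> \<one>"
  shows "card (multiples z \<union> (\<lambda>w. z \<otimes> w) ` multiples z) = 2 * card (multiples z)"
proof -
  have False if "x \<in> carrier G" "y \<in> carrier G" "z \<star> x = z \<otimes> (z \<star> y)" for x y
  proof -
    have "z \<otimes> (z \<star> (x \<otimes> y)) = \<one>"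
      using that z by (metis prd_distr cancel_twice m_comm m_assoc prd_closed exponent_two)
    then have "z = z \<star> (x \<otimes> y)" using that z by (metis eq_iff_product_one m_closed prd_closed)
    then show False using z that eq_own_multiple by blast
  qed
  then have "multiples z \<inter> (\<lambda>w. z \<otimes> w) ` multiples z = {}"
    by (auto simp: multiples_def)
  moreover have "inj_on (\<lambda>w. z \<otimes> w) (multiples z)"
    using z by (auto simp: inj_on_def multiples_def)
  moreover have "finite (multiples z)" using finite_carrier by (simp add: multiples_def)
  ultimately show ?thesis by (simp add: card_Un_disjoint card_image)
qed

text \<open>
  If every \<open>z G\<close> has at most two elements, any pair with \<open>z a \<noteq> 0\<close> works: commutativity gives
  \<open>t a = z a\<close> whenever \<open>t a \<noteq> 0\<close>. Otherwise some \<open>z G\<close> has at least four elements, and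
  \<open>2 |z G|\<^sup>2 \<le> |z G| |ann z| = |G| \<le> 32\<close> leaves no freedom: \<open>z G\<close> consists of
  \<open>0, p, q, p + q\<close> with \<open>p = z a\<close>, \<open>q = z b\<close>, and the annihilator of \<open>z\<close> is \<open>z G \<union> (z + z G)\<close>.
  Adding multiples of \<open>z\<close> to \<open>a\<close> and \<open>b\<close> makes \<open>a b = 0\<close>. Modulo \<open>z G\<close>, which annihilates
  \<open>a\<close> and \<open>b\<close>, every \<open>t\<close> is a combination of \<open>a\<close>, \<open>b\<close> and \<open>z\<close>, and \<open>t a \<noteq> 0\<close> forces the
  coefficient of \<open>z\<close> to be one. Then \<open>t a = p\<close> and \<open>t b = q\<close>, so \<open>t G\<close> contains \<open>z G\<close>.
\<close>

lemma exists_absorbing_pair: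
  assumes small: "order G \<le> 32"
    and nontrivial: "\<exists>x \<in> carrier G. \<exists>y \<in> carrier G. x \<star> y \<noteq> \<one>"
  shows "\<exists>z \<in> carrier G. \<exists>a \<in> carrier G. z \<star> a \<noteq> \<one> \<and>
    (\<forall>t \<in> carrier G. t \<star> a \<noteq> \<one> \<longrightarrow> multiples z \<subseteq> multiples t)"
proof (cases "\<exists>z \<in> carrier G. \<exists>a \<in> carrier G. \<exists>b \<in> carrier G.
    z \<star> a \<noteq> \<one> \<and> z \<star> b \<noteq> \<one> \<and> z \<star> a \<noteq> z \<star> b")
  case False
  then have two: "z \<star> x = z \<star> y"
    if "z \<in> carrier G" "x \<in> carrier G" "y \<in> carrier G" "z \<star> x \<noteq> \<one>" "z \<star> y \<noteq> \<one>" for z x y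
    using that by blast
  obtain z a where za: "z \<in> carrier G" "a \<in> carrier G" "z \<star> a \<noteq> \<one>" using nontrivial by blast
  have "multiples z \<subseteq> multiples t" if t: "t \<in> carrier G" "t \<star> a \<noteq> \<one>" for t
  proof
    fix v assume "v \<in> multiples z"
    then obtain x where x: "x \<in> carrier G" "v = z \<star> x" by (auto simp: multiples_def)
    show "v \<in> multiples t"
    proof (cases "v = \<one>")
      case True
      then show ?thesis using t by (auto simp: multiples_def intro: rev_image_eqI [of \<one>])
    next
      case False
      then have "v = z \<star> a" using two x za by blast
      also have "\<dots> = t \<star> a" using two [of a z t] za t prd_comm by simp
      finally show ?thesis using za by (auto simp: multiples_def)
    qed
  qed
  then show ?thesis using za by blast
next
  case True
  then obtain z a0 b0 where z [simp]: "z \<in> carrier G"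
    and a0 [simp]: "a0 \<in> carrier G" and b0 [simp]: "b0 \<in> carrier G"
    and pq0: "z \<star> a0 \<noteq> \<one>" "z \<star> b0 \<noteq> \<one>" "z \<star> a0 \<noteq> z \<star> b0" by blast
  define p q where "p = z \<star> a0" and "q = z \<star> b0"
  have [simp]: "p \<in> carrier G" "q \<in> carrier G" by (simp_all add: p_def q_def)
  have pq: "p \<noteq> \<one>" "q \<noteq> \<one>" "p \<noteq> q" "p \<otimes> q \<noteq> \<one>" "p \<otimes> q \<noteq> p" "p \<otimes> q \<noteq> q"
    using pq0 by (auto simp: eq_iff_product_one simp flip: p_def q_def)
  have four: "{\<one>, p, q, p \<otimes> q} \<subseteq> multiples z"
  proof -
    have "\<one> = z \<star> \<one>" "p \<otimes> q = z \<star> (a0 \<otimes> b0)" by (simp_all add: p_def q_def prd_distr)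
    then show ?thesis unfolding multiples_def p_def q_def
      by (metis (no_types, lifting) a0 b0 empty_subsetI image_eqI insert_subset m_closed one_closed)
  qed
  have c4: "card {\<one>, p, q, p \<otimes> q} = 4"
    using pq pq(1,2,5,6)[symmetric] by simp
  have fin: "finite (multiples z)" "finite (annihilator z)"
    using finite_carrier by (simp_all add: multiples_def annihilator_def)
  have m4: "4 \<le> card (multiples z)" using card_mono [OF fin(1) four] c4 by simp
  have z1: "z \<noteq> \<one>" using pq0 by auto
  note shift = annihilator_contains [OF z] card_multiples_and_shift [OF z z1]
  have an: "2 * card (multiples z) \<le> card (annihilator z)"
    using card_mono [OF fin(2) shift(1)] shift(2) by simp
  have le: "card (multiples z) * card (annihilator z) \<le> 32"
    using small card_annihilator [OF z] by simp
  have "card (multiples z) * (2 * card (multiples z)) \<le> 32"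
    using an le by (meson le_trans mult_le_mono2)
  then have m: "card (multiples z) = 4"
  proof -
    have "\<not> 5 \<le> card (multiples z)"
    proof
      assume "5 \<le> card (multiples z)"
      then have "5 * (2 * 5) \<le> card (multiples z) * (2 * card (multiples z))"
        by (intro mult_le_mono) auto
      with \<open>card (multiples z) * (2 * card (multiples z)) \<le> 32\<close> show False by simp
    qed
    with m4 show ?thesis by simp
  qed
  have mult_eq: "multiples z = {\<one>, p, q, p \<otimes> q}"
    using card_subset_eq [OF fin(1) four] m c4 by simp
  have "card (annihilator z) = 8" using an le m by simp
  then have ann_eq: "annihilator z = multiples z \<union> (\<lambda>w. z \<otimes> w) ` multiples z"
    using card_subset_eq [OF fin(2) shift(1)] shift(2) m by simp
  have ann_cases: "\<exists>c \<in> {\<one>, z}. \<exists>w \<in> {\<one>, p, q, p \<otimes> q}. x = c \<otimes> w"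
    if "x \<in> carrier G" "z \<star> x = \<one>" for x
  proof -
    have "x \<in> annihilator z" using that by (simp add: annihilator_def)
    then show ?thesis unfolding ann_eq mult_eq by auto
  qed
  \<comment> \<open>The element \<open>z a b\<close> lies in \<open>z G\<close>; each of its three nonzero values would make \<open>p\<close>, \<open>q\<close>
    or \<open>z a b\<close> itself vanish.\<close>
  have zab: "z \<star> (a \<star> b) = \<one>"
    if [simp]: "a \<in> carrier G" "b \<in> carrier G" and ab: "z \<star> a = p" "z \<star> b = q" for a b
  proof (rule ccontr)
    assume ne: "z \<star> (a \<star> b) \<noteq> \<one>"
    have pb: "p \<star> b = z \<star> (a \<star> b)" and qa: "q \<star> a = z \<star> (a \<star> b)"
      using that by (auto simp: prd_assoc prd_comm [of b a] simp flip: ab)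
    have "z \<star> (a \<star> b) \<in> multiples z" by (auto simp: multiples_def)
    then consider "p \<star> b = p" | "q \<star> a = q" | "p \<star> b = p \<otimes> q"
      unfolding mult_eq using ne pb qa by auto
    then show False
    proof cases
      case 1 then show False using eq_own_multiple [of p b] pq by simp
    next
      case 2 then show False using eq_own_multiple [of q a] pq by simp
    next
      case 3
      have "q \<star> b = \<one>" using that by (simp flip: ab)
      moreover have "p \<star> b \<star> b = (p \<otimes> q) \<star> b" using 3 by simp
      ultimately have "p \<star> b = \<one>" by (simp add: prd_distr2)
      then show False using ne pb by simp
    qed
  qed
  have wa: "w \<star> a = \<one>" "w \<star> b = \<one>"
    if [simp]: "a \<in> carrier G" "b \<in> carrier G" and ab: "z \<star> a = p" "z \<star> b = q"
      and w: "w \<in> {\<one>, p, q, p \<otimes> q}" for a b w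
  proof -
    have "p \<star> a = \<one>" "q \<star> b = \<one>" using that by (simp_all flip: ab)
    moreover have "p \<star> b = \<one>" "q \<star> a = \<one>"
      using zab [OF that(1-4)] by (simp_all add: prd_assoc prd_comm [of b a] flip: ab)
    ultimately show "w \<star> a = \<one>" "w \<star> b = \<one>" using w by (auto simp: prd_distr2)
  qed
  obtain a b where a [simp]: "a \<in> carrier G" and b [simp]: "b \<in> carrier G"
    and ab: "z \<star> a = p" "z \<star> b = q" "a \<star> b = \<one>"
  proof -
    have ab0: "z \<star> a0 = p" "z \<star> b0 = q" by (simp_all add: p_def q_def)
    have "\<exists>c \<in> {\<one>, z}. \<exists>w \<in> {\<one>, p, q, p \<otimes> q}. a0 \<star> b0 = c \<otimes> w"
      by (rule ann_cases [OF _ zab [OF a0 b0 ab0]]) simp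
    then obtain c w where cw: "c \<in> {\<one>, z}" "w \<in> {\<one>, p, q, p \<otimes> q}" "a0 \<star> b0 = c \<otimes> w"
      by blast
    then have [simp]: "c \<in> carrier G" "w \<in> carrier G" by auto
    have "\<one> = (c \<otimes> w) \<star> a0" by (simp flip: cw(3))
    then have "c \<star> a0 = \<one>" using wa [OF a0 b0 ab0 cw(2)] by (simp add: prd_distr2)
    then have "c = \<one>" using cw(1) ab0 pq by auto
    then have "a0 \<star> b0 = w" using cw by simp
    moreover have "a0 \<star> z = p" "b0 \<star> z = q" using ab0 prd_comm by auto
    \<comment> \<open>The product of the two elements is \<open>0\<close>, \<open>p\<close>, \<open>q\<close> or \<open>p + q\<close>, and adding \<open>z\<close> to one or both of them
      changes it by \<open>p\<close>, \<open>q\<close> or \<open>p + q\<close>.\<close>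
    ultimately consider "a0 \<star> b0 = \<one>" | "a0 \<star> (b0 \<otimes> z) = \<one>" | "(a0 \<otimes> z) \<star> b0 = \<one>"
      | "(a0 \<otimes> z) \<star> (b0 \<otimes> z) = \<one>"
      using cw(2) ab0 by (auto simp: prd_distr prd_distr2 m_ac)
    then show thesis
    proof cases
      case 1 show thesis by (rule that [of a0 b0]) (simp_all add: ab0 1)
    next
      case 2 show thesis by (rule that [of a0 "b0 \<otimes> z"]) (simp_all add: ab0 2 prd_distr)
    next
      case 3 show thesis by (rule that [of "a0 \<otimes> z" b0]) (simp_all add: ab0 3 prd_distr)
    next
      case 4 show thesis by (rule that [of "a0 \<otimes> z" "b0 \<otimes> z"]) (simp_all add: ab0 4 prd_distr)
    qed
  qed
  have "multiples z \<subseteq> multiples t" if t: "t \<in> carrier G" "t \<star> a \<noteq> \<one>" for t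
  proof -
    have "z \<star> t \<in> multiples z" using t by (auto simp: multiples_def)
    then have "\<exists>u \<in> {\<one>, a, b, a \<otimes> b}. z \<star> t = z \<star> u"
      unfolding mult_eq by (auto simp: ab prd_distr)
    then obtain u where u: "u \<in> {\<one>, a, b, a \<otimes> b}" "z \<star> t = z \<star> u" by blast
    then have [simp]: "u \<in> carrier G" by auto
    have "z \<star> (t \<otimes> u) = \<one>" using u t by (simp add: prd_distr)
    then have "\<exists>c \<in> {\<one>, z}. \<exists>w \<in> {\<one>, p, q, p \<otimes> q}. t \<otimes> u = c \<otimes> w"
      using t by (intro ann_cases) simp_all
    then obtain c w where cw: "c \<in> {\<one>, z}" "w \<in> {\<one>, p, q, p \<otimes> q}" "t \<otimes> u = c \<otimes> w"
      by blast
    then have [simp]: "c \<in> carrier G" "w \<in> carrier G" by auto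
    have "u \<otimes> (t \<otimes> u) = t" using t by (simp add: m_comm [of t u])
    then have t_eq: "t = u \<otimes> (c \<otimes> w)" using cw(3) by simp
    have ua: "u \<star> a = \<one>" "u \<star> b = \<one>"
      using u(1) ab prd_comm [of b a] by (auto simp: prd_distr2)
    have tc: "t \<star> a = c \<star> a" "t \<star> b = c \<star> b"
      using wa [OF a b ab(1,2) cw(2)] by (simp_all add: t_eq prd_distr2 ua)
    then have "c = z" using t cw(1) by auto
    then have "t \<star> a = p" "t \<star> b = q" using tc ab by auto
    then have "t \<star> \<one> = \<one>" "t \<star> (a \<otimes> b) = p \<otimes> q" using t by (auto simp: prd_distr)
    then show ?thesis unfolding mult_eq unfolding multiples_def
      using \<open>t \<star> a = p\<close> \<open>t \<star> b = q\<close> a b m_closed one_closed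
      by (metis (no_types, lifting) empty_subsetI image_eqI insert_subset)
  qed
  moreover have "z \<star> a \<noteq> \<one>" using ab pq by simp
  ultimately show ?thesis using z a by blast
qed

text \<open>
  The map \<open>f\<close> below is the identity on the annihilator of \<open>a\<close> and multiplication by \<open>1 + z\<close> off it.
  Points on the same side satisfy \<open>f x - f y = (x - y)(1 + e)\<close> with \<open>e = 0\<close> or \<open>e = z\<close>. Points on
  different sides do so because their difference \<open>t\<close> has \<open>t a \<noteq> 0\<close>, hence \<open>z G \<subseteq> t G\<close>. So \<open>f\<close> agrees on any
  two points with an element of \<open>K\<close>, but it does not respect the sum \<open>z + a\<close>.
\<close>

lemma two_closed_not_in_holomorph:
  assumes small: "order G \<le> 32"
    and nontrivial: "\<exists>x \<in> carrier G. \<exists>y \<in> carrier G. x \<star> y \<noteq> \<one>"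
    and K: "subgroup K (Sym G)" "two_closed G K" "right_translations G \<subseteq> K"
      "circle_translation ` carrier G \<subseteq> K"
  shows "\<not> K \<subseteq> holomorph G"
proof
  assume hol: "K \<subseteq> holomorph G"
  obtain z a where [simp]: "z \<in> carrier G" "a \<in> carrier G" and za: "z \<star> a \<noteq> \<one>"
    and absorb: "\<And>t. \<lbrakk>t \<in> carrier G; t \<star> a \<noteq> \<one>\<rbrakk> \<Longrightarrow> multiples z \<subseteq> multiples t"
    using exists_absorbing_pair [OF small nontrivial] by blast
  define f where "f = (\<lambda>u \<in> carrier G. if u \<star> a = \<one> then u else u \<otimes> (u \<star> z))"
  have fc [simp]: "f x \<in> carrier G" if "x \<in> carrier G" for x
    using that by (simp add: f_def)
  have diff: "\<exists>e \<in> carrier G. f x \<otimes> f y = x \<otimes> y \<otimes> ((x \<otimes> y) \<star> e)"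
    if [simp]: "x \<in> carrier G" "y \<in> carrier G" for x y
  proof -
    have jump: "\<exists>e \<in> carrier G. v \<star> z = (x \<otimes> y) \<star> e"
      if "v \<in> carrier G" "(x \<otimes> y) \<star> a \<noteq> \<one>" for v
    proof -
      have "v \<star> z \<in> multiples z" using that by (auto simp: multiples_def prd_comm)
      then show ?thesis using absorb [of "x \<otimes> y"] that by (auto simp: multiples_def)
    qed
    consider "x \<star> a = \<one>" "y \<star> a = \<one>" | "x \<star> a \<noteq> \<one>" "y \<star> a \<noteq> \<one>"
      | "x \<star> a = \<one>" "y \<star> a \<noteq> \<one>" | "x \<star> a \<noteq> \<one>" "y \<star> a = \<one>" by blast
    then show ?thesis
    proof cases
      case 1 then show ?thesis by (intro bexI [of _ \<one>]) (auto simp: f_def)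
    next
      case 2 then show ?thesis by (intro bexI [of _ z]) (auto simp: f_def prd_distr2 m_ac)
    next
      case 3
      then have "(x \<otimes> y) \<star> a \<noteq> \<one>" by (simp add: prd_distr2)
      then obtain e where "e \<in> carrier G" "y \<star> z = (x \<otimes> y) \<star> e" using jump [of y] by auto
      then show ?thesis using 3 by (intro bexI [of _ e]) (auto simp: f_def m_ac)
    next
      case 4
      then have "(x \<otimes> y) \<star> a \<noteq> \<one>" by (simp add: prd_distr2)
      then obtain e where "e \<in> carrier G" "x \<star> z = (x \<otimes> y) \<star> e" using jump [of x] by auto
      then show ?thesis using 4 by (intro bexI [of _ e]) (auto simp: f_def m_ac)
    qed
  qed
  have "inj_on f (carrier G)"
  proof
    fix x y assume c: "x \<in> carrier G" "y \<in> carrier G" and eq: "f x = f y"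
    obtain e where e: "e \<in> carrier G" "f x \<otimes> f y = x \<otimes> y \<otimes> ((x \<otimes> y) \<star> e)" using diff [OF c] by blast
    then have "x \<otimes> y = (x \<otimes> y) \<star> e" using eq c by (metis eq_iff_product_one exponent_two fc m_closed prd_closed)
    then have "x \<otimes> y = \<one>" using eq_own_multiple [of "x \<otimes> y" e] c e by simp
    then show "x = y" using c by (simp add: eq_iff_product_one)
  qed
  moreover have "f ` carrier G \<subseteq> carrier G" by auto
  ultimately have "bij_betw f (carrier G) (carrier G)"
    using endo_inj_surj [OF finite_carrier] by (simp add: bij_betw_def)
  then have fB: "f \<in> Bij (carrier G)" by (simp add: Bij_def f_def)
  have "\<exists>k \<in> K. f x = k x \<and> f y = k y" if [simp]: "x \<in> carrier G" "y \<in> carrier G" for x y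
  proof -
    obtain e where [simp]: "e \<in> carrier G" and e: "f x \<otimes> f y = x \<otimes> y \<otimes> ((x \<otimes> y) \<star> e)"
      using diff [of x y] by auto
    \<comment> \<open>The circle translation by \<open>e\<close> gives the right difference of values; the translation by \<open>c\<close>
      corrects the value at \<open>x\<close>.\<close>
    define c where "c = f x \<otimes> (e \<otimes> (x \<otimes> (e \<star> x)))"
    have [simp]: "c \<in> carrier G" by (simp add: c_def)
    let ?k = "compose (carrier G) (translation c) (circle_translation e)"
    have tK: "translation c \<in> K" "circle_translation e \<in> K"
      using K(3,4) by (auto simp: right_translations_eq)
    moreover have "K \<subseteq> Bij (carrier G)" using hol holomorph_iff by blast
    ultimately have "?k \<in> K"
      using subgroup.m_closed [OF K(1) tK] by (simp add: Sym_mult subset_iff)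
    moreover have k: "?k t = e \<otimes> t \<otimes> (e \<star> t) \<otimes> c" if "t \<in> carrier G" for t
      using that by (simp add: compose_def translation_def circle_translation_def)
    have "e \<otimes> x \<otimes> (e \<star> x) \<otimes> c = f x" by (simp add: c_def m_ac)
    then have "?k x = f x" by (simp only: k that)
    moreover have "?k y = f y"
    proof -
      have "e \<otimes> y \<otimes> (e \<star> y) \<otimes> c = f x \<otimes> (x \<otimes> y \<otimes> ((x \<otimes> y) \<star> e))"
        by (simp add: c_def m_ac prd_comm [of _ e] prd_distr)
      then have "?k y = f x \<otimes> (x \<otimes> y \<otimes> ((x \<otimes> y) \<star> e))" by (simp only: k that)
      also have "\<dots> = f y" by (simp flip: e)
      finally show ?thesis .
    qed
    ultimately show ?thesis by metis
  qed
  then have "f \<in> two_closure G K" using fB by (simp add: two_closure_eq [OF K(1)])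
  then have "f \<in> holomorph G" using K(2) hol by (auto simp: two_closed_def)
  then have "f (z \<otimes> a) \<otimes> f \<one> = f z \<otimes> f a" by (simp add: holomorph_iff)
  then have "z \<otimes> a \<otimes> (a \<star> z) = z \<otimes> a" using za by (simp add: f_def prd_distr2)
  then have "a \<star> z = \<one>" by simp
  then show False using za prd_comm by simp
qed

end

context comm_group
begin

lemma NCI2_group_if_small_elementary:
  assumes fin: "finite (carrier G)" and exp2: "\<And>x. x \<in> carrier G \<Longrightarrow> x \<otimes> x = \<one>"
    and small: "order G \<le> 32"
  shows "NCI2_group G"
  unfolding NCI2_group_def
proof (intro allI impI, elim conjE)
  fix K assume K: "subgroup K (Sym G)" "two_closed G K" "right_translations G \<subseteq> K" "K \<subseteq> holomorph G"
  show "G_transjugate G K"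
    unfolding transjugate_in_holomorph_iff [OF K(1,3,4)]
  proof (intro allI impI, elim conjE)
    fix R assume R: "G_regular G R" "R \<subseteq> K"
    then have RH: "R \<subseteq> holomorph G" using K(4) by blast
    obtain prd where prd: "group_product G prd" "R = group_product.circle_translation G prd ` carrier G"
      using G_regular_in_holomorph_product [OF R(1) RH] .
    interpret group_product G prd by (rule prd)
    have sub: "subgroup R (Sym G)" and iso: "(Sym G)\<lparr>carrier := R\<rparr> \<cong> G"
      using R(1) by (auto simp: G_regular_def)
    have Bij: "circle_translation ` carrier G \<subseteq> Bij (carrier G)"
      using RH prd(2) holomorph_iff by blast
    have "G \<cong> (Sym G)\<lparr>carrier := R\<rparr>" using iso group.iso_sym group_subgroup_Sym [OF sub] by blast
    then have "f \<otimes>\<^bsub>Sym G\<^esub> f = \<one>\<^bsub>Sym G\<^esub>" if "f \<in> R" for f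
      using exponent_two_iso [OF is_group group_subgroup_Sym [OF sub] _ exp2, of f] that by simp
    then have "a \<otimes> a \<otimes> prd a a = \<one>" if "a \<in> carrier G" for a
      using circle_square [OF Bij that] that prd(2) by blast
    then have "prd a a = \<one>" if "a \<in> carrier G" for a
      using that exp2 by simp
    then interpret square_zero_product G prd
      using fin exp2 by unfold_locales auto
    have "prd x y = \<one>" if "x \<in> carrier G" "y \<in> carrier G" for x y
      using two_closed_not_in_holomorph [OF small _ K(1-3)] K(4) R(2) prd(2) that by blast
    then show "R = right_translations G"
      using circle_translations_trivial prd(2) by simp
  qed
qed

end

section \<open>The cyclic group of order four\<close>

context comm_group
begin

text \<open>
  For a generator \<open>g\<close> write \<open>g g = c g\<close> with \<open>0 \<le> c < 4\<close>, so that \<open>(i g)(j g) = (c i j) g\<close>. If \<open>c\<close> is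
  odd, some circle translation is not injective. If \<open>c = 2\<close>, then \<open>R\<close> has exponent two and is not
  isomorphic to \<open>C\<^sub>4\<close>. So the product is zero.
\<close>

lemma NCI2_group_if_cyclic_four:
  assumes Z4: "G \<cong> integer_mod_group 4"
  shows "NCI2_group G"
  unfolding NCI2_group_def
proof (intro allI impI, elim conjE)
  fix K assume K: "subgroup K (Sym G)" "right_translations G \<subseteq> K" "K \<subseteq> holomorph G"
  show "G_transjugate G K"
    unfolding transjugate_in_holomorph_iff [OF K]
  proof (intro allI impI, elim conjE)
    fix R assume R: "G_regular G R" "R \<subseteq> K"
    then have RH: "R \<subseteq> holomorph G" using K(3) by blast
    obtain prd where prd: "group_product G prd" "R = group_product.circle_translation G prd ` carrier G"
      using G_regular_in_holomorph_product [OF R(1) RH] .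
    interpret group_product G prd by (rule prd)
    have sub: "subgroup R (Sym G)" and iso: "(Sym G)\<lparr>carrier := R\<rparr> \<cong> G"
      using R(1) by (auto simp: G_regular_def)
    have Bij: "circle_translation ` carrier G \<subseteq> Bij (carrier G)"
      using RH prd(2) holomorph_iff by blast
    obtain \<psi> where \<psi>: "\<psi> \<in> iso (integer_mod_group 4) G"
      using iso_sym [OF Z4] by (auto simp: is_iso_def)
    then have "\<psi> \<in> hom (integer_mod_group 4) G" by (simp add: iso_def)
    then interpret \<psi>: group_hom "integer_mod_group 4" G \<psi>
      by (simp add: group_hom_def group_hom_axioms_def)
    define g where "g = \<psi> 1"
    have g [simp]: "g \<in> carrier G" by (simp add: g_def)
    have g_pow: "g [^] n = \<psi> (int n mod 4)" for n :: nat
      using \<psi>.hom_nat_pow [of 1 n] by (simp add: g_def)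
    have \<psi>_inj: "inj_on \<psi> {0..<4}" and \<psi>_surj: "\<psi> ` {0..<4} = carrier G"
      using \<psi> by (auto simp: iso_def bij_betw_def carrier_integer_mod_group)
    have g_eq: "g [^] m = g [^] n \<longleftrightarrow> m mod 4 = n mod 4" for m n :: nat
    proof -
      have "g [^] m = g [^] n \<longleftrightarrow> int m mod 4 = int n mod 4"
        unfolding g_pow using \<psi>_inj by (auto simp: inj_on_eq_iff)
      then show ?thesis by (metis of_nat_eq_iff of_nat_numeral zmod_int)
    qed
    have gen: "\<exists>i::nat. i < 4 \<and> x = g [^] i" if "x \<in> carrier G" for x
    proof -
      have "x \<in> \<psi> ` {0..<4}" using \<psi>_surj that by simp
      then obtain j where "0 \<le> j" "j < 4" "x = \<psi> j" by auto
      then show ?thesis by (intro exI [of _ "nat j"]) (simp add: g_pow)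
    qed
    have pow1: "prd x (g [^] j) = prd x g [^] j" if "x \<in> carrier G" for x and j :: nat
      using that by (induction j) (simp_all add: prd_distr)
    obtain c :: nat where c: "c < 4" "prd g g = g [^] c" using gen [of "prd g g"] by auto
    have prd_pow: "prd (g [^] i) (g [^] j) = g [^] (c * i * j)" for i j :: nat
    proof -
      have "prd (g [^] i) g = g [^] (c * i)"
        using pow1 [of g i] c(2) by (simp add: prd_comm [of "g [^] i" g] nat_pow_pow)
      then show ?thesis using pow1 [of "g [^] i" j] by (simp add: nat_pow_pow)
    qed
    have circ: "circle_translation (g [^] i) (g [^] j) = g [^] (i + j + c * i * j)" for i j :: nat
      by (simp add: circle_translation_def prd_pow nat_pow_mult)
    have circ_inj: "m mod 4 = n mod 4"
      if "(i + m + c * i * m) mod 4 = (i + n + c * i * n) mod 4" for i m n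
    proof -
      have "circle_translation (g [^] i) \<in> Bij (carrier G)" by (rule subsetD [OF Bij]) simp
      then have "inj_on (circle_translation (g [^] i)) (carrier G)" by (simp add: Bij_def bij_betw_def)
      moreover have "circle_translation (g [^] i) (g [^] m) = circle_translation (g [^] i) (g [^] n)"
        unfolding circ g_eq by (rule that)
      ultimately show ?thesis by (simp add: inj_on_eq_iff g_eq)
    qed
    have "c \<noteq> 1" using circ_inj [of 3 1 0] by auto
    moreover have "c \<noteq> 3" using circ_inj [of 1 1 0] by auto
    moreover have "c \<noteq> 2"
    proof
      assume "c = 2"
      have "a \<otimes> a \<otimes> prd a a = \<one>" if a: "a \<in> carrier G" for a
      proof -
        obtain i :: nat where i: "a = g [^] i" using gen [OF a] by blast
        have "2 * 2 dvd 2 * (i * (i + 1))" by (rule mult_dvd_mono) simp_all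
        then have "(i + i + c * i * i) mod 4 = 0 mod 4"
          using \<open>c = 2\<close> by (simp add: algebra_simps mod_eq_0_iff_dvd)
        then have "g [^] (i + i + c * i * i) = g [^] (0::nat)" unfolding g_eq .
        then show ?thesis by (simp add: i prd_pow nat_pow_mult)
      qed
      then have "f \<otimes>\<^bsub>Sym G\<^esub> f = \<one>\<^bsub>Sym G\<^esub>" if "f \<in> R" for f
        using circle_square [OF Bij] that prd(2) by blast
      then have "g \<otimes> g = \<one>"
        using exponent_two_iso [OF group_subgroup_Sym [OF sub] is_group iso _ g] by simp
      then have "g [^] (2::nat) = g [^] (0::nat)" by (simp add: eval_nat_numeral)
      then show False unfolding g_eq by simp
    qed
    ultimately have "c = 0" using c(1) by auto
    then have "prd x y = \<one>" if "x \<in> carrier G" "y \<in> carrier G" for x y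
      using gen [OF that(1)] gen [OF that(2)] prd_pow by auto
    then show "R = right_translations G"
      using circle_translations_trivial prd(2) by simp
  qed
qed

end

section \<open>Quadratic maps that obstruct the property\<close>

context group_product
begin

lemma prd_inv: "\<lbrakk>x \<in> carrier G; y \<in> carrier G\<rbrakk> \<Longrightarrow> x \<star> inv y = inv (x \<star> y)"
  by (rule inv_equality [symmetric]) (simp_all flip: prd_distr)

lemma prd_inv2: "\<lbrakk>x \<in> carrier G; y \<in> carrier G\<rbrakk> \<Longrightarrow> inv x \<star> y = inv (x \<star> y)"
  using prd_inv [of y x] by (simp add: prd_comm)

text \<open>
  The hypothesis says that \<open>T\<close> is an isomorphism from \<open>G\<close> to \<open>G\<close> with the circle operation, so
  \<open>a \<mapsto> circle_translation (T a)\<close> is the regular representation of \<open>G\<close> transported along \<open>T\<close>.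
\<close>

lemma G_regular_circle_translations:
  assumes T: "bij_betw T (carrier G) (carrier G)"
    and hom: "\<And>x y. \<lbrakk>x \<in> carrier G; y \<in> carrier G\<rbrakk> \<Longrightarrow> T (x \<otimes> y) = T x \<otimes> T y \<otimes> (T x \<star> T y)"
  shows "G_regular G (circle_translation ` carrier G)"
proof -
  have Tc [simp]: "T x \<in> carrier G" if "x \<in> carrier G" for x
    using that T by (auto simp: bij_betw_def)
  let ?h = "\<lambda>a. circle_translation (T a)"
  have comp: "compose (carrier G) (?h a) (?h b) = ?h (a \<otimes> b)"
    if "a \<in> carrier G" "b \<in> carrier G" for a b
    using that by (simp add: compose_circle_translation hom)
  have "T \<one> = \<one>"
  proof -
    obtain u where u: "u \<in> carrier G" "T u = \<one>"
      using T by (metis bij_betw_imp_surj_on imageE one_closed)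
    then have "T u = T \<one>" using hom [of u \<one>] by simp
    then show ?thesis using u by simp
  qed
  then have id: "?h \<one> = (\<lambda>x \<in> carrier G. x)" by (simp add: circle_translation_one BijGroup_def)
  have B: "?h a \<in> Bij (carrier G)" if a: "a \<in> carrier G" for a
  proof -
    have "?h (inv a) (?h a x) = x" "?h a (?h (inv a) x) = x" if "x \<in> carrier G" for x
      using comp [of a "inv a"] comp [of "inv a" a] a that id by (metis compose_eq inv_closed l_inv r_inv restrict_apply')+
    then have "bij_betw (?h a) (carrier G) (carrier G)"
      using a by (intro bij_betw_byWitness [where f' = "?h (inv a)"]) (auto simp: circle_translation_closed)
    then show ?thesis by (simp add: Bij_def circle_translation_def)
  qed
  have hh: "?h \<in> hom G (Sym G)"
    using B comp by (simp add: hom_def Pi_iff Sym_mult) (simp add: BijGroup_def)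
  then interpret h: group_hom G "Sym G" ?h
    using Sym_group by (simp add: group_hom_def group_hom_axioms_def)
  define R where "R = circle_translation ` carrier G"
  have R_eq: "R = ?h ` carrier G"
    using T unfolding R_def by (metis bij_betw_imp_surj_on image_image)
  have at_one: "circle_translation a \<one> = a" if "a \<in> carrier G" for a
    using that by (simp add: circle_translation_def)
  have sub: "subgroup R (Sym G)" unfolding R_eq by (rule h.img_is_subgroup)
  have RB: "circle_translation a \<in> Bij (carrier G)" if "a \<in> carrier G" for a
    using that subgroup.subset [OF sub] by (auto simp: R_def BijGroup_def)
  have "regular_on (carrier G) R"
    unfolding regular_on_subgroup_iff [OF sub]
  proof (intro conjI ballI impI)
    fix x y assume c: "x \<in> carrier G" "y \<in> carrier G"
    let ?f = "circle_translation y \<otimes>\<^bsub>Sym G\<^esub> inv\<^bsub>Sym G\<^esub> circle_translation x"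
    have "?f \<in> R" using sub c by (simp add: R_def subgroup.m_closed subgroup.m_inv_closed)
    moreover have "?f x = y"
    proof -
      have "inv_into (carrier G) (circle_translation x) x = \<one>"
        using RB [OF c(1)] at_one [OF c(1)] by (intro inv_into_f_eq) (auto simp: Bij_def bij_betw_def)
      then show ?thesis using c at_one
        by (simp add: inv_BijGroup RB Sym_mult restrict_inv_into_Bij compose_def)
    qed
    ultimately show "\<exists>f \<in> R. f x = y" by blast
  next
    fix f x assume f: "f \<in> R" and x: "x \<in> carrier G" and fx: "f x = x"
    then obtain a where a: "a \<in> carrier G" "f = circle_translation a" by (auto simp: R_def)
    have "a \<otimes> x \<otimes> (a \<star> x) = x" using a fx x by (simp add: circle_translation_def)
    then have "f \<otimes>\<^bsub>Sym G\<^esub> circle_translation x = circle_translation x"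
      using a x by (simp add: Sym_mult RB compose_circle_translation)
    then have "f = \<one>\<^bsub>Sym G\<^esub>"
      using a x RB group.l_cancel_one [OF Sym_group] h.H.r_cancel_one
      by (metis BijGroup_def partial_object.select_convs(1))
    then show "f = (\<lambda>x \<in> carrier G. x)" by (simp add: BijGroup_def)
  qed
  moreover have "(Sym G)\<lparr>carrier := R\<rparr> \<cong> G"
  proof -
    have "inj_on ?h (carrier G)"
    proof
      fix x y assume c: "x \<in> carrier G" "y \<in> carrier G" "?h x = ?h y"
      then have "T x = T y" using at_one by (metis Tc)
      then show "x = y" using c(1,2) T by (meson bij_betw_imp_inj_on inj_onD)
    qed
    then have "?h \<in> iso G ((Sym G)\<lparr>carrier := R\<rparr>)"
      using hh by (simp add: iso_def hom_def bij_betw_def R_eq)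
    then show ?thesis by (intro iso_sym is_isoI)
  qed
  ultimately show ?thesis using sub by (simp add: G_regular_def R_def)
qed

text \<open>
  Let \<open>K\<close> consist of the permutations \<open>f\<close> with \<open>f x - f y \<in> d + d G\<close> for all \<open>x\<close>, \<open>y\<close>, where
  \<open>d = x - y\<close>. This condition only concerns pairs of values, so \<open>K\<close> is 2-closed; it is a group because
  triple products vanish, which gives \<open>d' G = d G\<close> for every \<open>d' \<in> d + d G\<close>. It contains the circle
  translations. Rigidity makes every \<open>f \<in> K\<close> affine: apply it to \<open>x \<mapsto> f x - x - f 0\<close>.
\<close>

lemma not_NCI2_group_if_rigid:
  assumes triple: "\<And>x y z. \<lbrakk>x \<in> carrier G; y \<in> carrier G; z \<in> carrier G\<rbrakk> \<Longrightarrow> x \<star> y \<star> z = \<one>"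
    and nontrivial: "\<exists>x \<in> carrier G. \<exists>y \<in> carrier G. x \<star> y \<noteq> \<one>"
    and T: "bij_betw T (carrier G) (carrier G)"
      "\<And>x y. \<lbrakk>x \<in> carrier G; y \<in> carrier G\<rbrakk> \<Longrightarrow> T (x \<otimes> y) = T x \<otimes> T y \<otimes> (T x \<star> T y)"
    and rigid: "\<And>g x y. \<lbrakk>g \<in> carrier G \<rightarrow> carrier G; g \<one> = \<one>;
        \<And>x y. \<lbrakk>x \<in> carrier G; y \<in> carrier G\<rbrakk> \<Longrightarrow>
          \<exists>e \<in> carrier G. g x \<otimes> inv (g y) = (x \<otimes> inv y) \<star> e;
        x \<in> carrier G; y \<in> carrier G\<rbrakk> \<Longrightarrow> g (x \<otimes> y) = g x \<otimes> g y"
  shows "\<not> NCI2_group G"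
proof
  assume NCI: "NCI2_group G"
  define K where "K = {f \<in> Bij (carrier G). \<forall>x \<in> carrier G. \<forall>y \<in> carrier G.
    \<exists>e \<in> carrier G. f x \<otimes> inv (f y) = x \<otimes> inv y \<otimes> ((x \<otimes> inv y) \<star> e)}"
  have KD: "\<exists>e \<in> carrier G. f x \<otimes> inv (f y) = x \<otimes> inv y \<otimes> ((x \<otimes> inv y) \<star> e)"
    if "f \<in> K" "x \<in> carrier G" "y \<in> carrier G" for f x y
    using that by (auto simp: K_def)
  have KB: "f \<in> Bij (carrier G)" if "f \<in> K" for f using that by (simp add: K_def)
  note Kc = Bij_closed [OF KB]
  have R: "G_regular G (circle_translation ` carrier G)"
    by (rule G_regular_circle_translations [OF T])
  then have RB: "circle_translation a \<in> Bij (carrier G)" if "a \<in> carrier G" for a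
    using that subgroup.subset by (fastforce simp: G_regular_def BijGroup_def)
  have sub: "subgroup K (Sym G)"
  proof (rule subgroup.intro)
    show "K \<subseteq> carrier (Sym G)" by (auto simp: K_def BijGroup_def)
    show "\<one>\<^bsub>Sym G\<^esub> \<in> K" by (auto simp: K_def BijGroup_def id_Bij intro!: bexI [of _ \<one>])
  next
    fix f h assume f: "f \<in> K" and h: "h \<in> K"
    have "\<exists>e \<in> carrier G. f (h x) \<otimes> inv (f (h y)) = x \<otimes> inv y \<otimes> ((x \<otimes> inv y) \<star> e)"
      if c: "x \<in> carrier G" "y \<in> carrier G" for x y
    proof -
      obtain e where e: "e \<in> carrier G" "h x \<otimes> inv (h y) = x \<otimes> inv y \<otimes> ((x \<otimes> inv y) \<star> e)"
        using KD [OF h c] by blast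
      obtain e' where e': "e' \<in> carrier G"
        "f (h x) \<otimes> inv (f (h y)) = h x \<otimes> inv (h y) \<otimes> ((h x \<otimes> inv (h y)) \<star> e')"
        using KD [OF f] h c Kc by blast
      have "f (h x) \<otimes> inv (f (h y)) = x \<otimes> inv y \<otimes> ((x \<otimes> inv y) \<star> (e \<otimes> e'))"
        unfolding e'(2) e(2) using e(1) e'(1) c
        by (simp add: prd_distr2 [of _ _ e'] prd_distr [of _ e e'] triple m_assoc)
      then show ?thesis using e e' by blast
    qed
    then show "f \<otimes>\<^bsub>Sym G\<^esub> h \<in> K"
      using KB [OF f] KB [OF h] compose_Bij [OF KB [OF f] KB [OF h]]
      by (simp add: Sym_mult K_def compose_eq)
  next
    fix f assume f: "f \<in> K"
    let ?i = "inv_into (carrier G) f"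
    have "\<exists>e \<in> carrier G. ?i x \<otimes> inv (?i y) = x \<otimes> inv y \<otimes> ((x \<otimes> inv y) \<star> e)"
      if c: "x \<in> carrier G" "y \<in> carrier G" for x y
    proof -
      have i [simp]: "?i x \<in> carrier G" "?i y \<in> carrier G" "f (?i x) = x" "f (?i y) = y"
        using KB [OF f] c Bij_inv_into_mem [OF KB [OF f]]
        by (auto simp: Bij_def bij_betw_def f_inv_into_f)
      obtain e where e: "e \<in> carrier G"
        "x \<otimes> inv y = ?i x \<otimes> inv (?i y) \<otimes> ((?i x \<otimes> inv (?i y)) \<star> e)"
        using KD [OF f i(1,2)] by auto
      define d where "d = ?i x \<otimes> inv (?i y)"
      have [simp]: "d \<in> carrier G" by (simp add: d_def)
      have "x \<otimes> inv y \<otimes> ((x \<otimes> inv y) \<star> inv e) = d"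
        unfolding e(2) d_def [symmetric] using e(1)
        by (simp add: prd_distr2 prd_inv triple m_assoc)
      then show ?thesis using e(1) by (metis d_def inv_closed)
    qed
    then show "inv\<^bsub>Sym G\<^esub> f \<in> K"
      using KB [OF f] by (simp add: K_def inv_BijGroup restrict_inv_into_Bij)
  qed
  have closed: "two_closed G K"
    unfolding two_closed_def two_closure_eq [OF sub]
  proof (intro equalityI subsetI)
    fix f assume f: "f \<in> K"
    then show "f \<in> {f \<in> Bij (carrier G). \<forall>x \<in> carrier G. \<forall>y \<in> carrier G. \<exists>k \<in> K. f x = k x \<and> f y = k y}"
      using KB by blast
  next
    fix f assume "f \<in> {f \<in> Bij (carrier G). \<forall>x \<in> carrier G. \<forall>y \<in> carrier G. \<exists>k \<in> K. f x = k x \<and> f y = k y}"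
    then have f: "f \<in> Bij (carrier G)"
      and k: "\<And>x y. \<lbrakk>x \<in> carrier G; y \<in> carrier G\<rbrakk> \<Longrightarrow> \<exists>k \<in> K. f x = k x \<and> f y = k y" by auto
    have "\<exists>e \<in> carrier G. f x \<otimes> inv (f y) = x \<otimes> inv y \<otimes> ((x \<otimes> inv y) \<star> e)"
      if c: "x \<in> carrier G" "y \<in> carrier G" for x y
      using k [OF c] KD [OF _ c] by metis
    then show "f \<in> K" using f by (auto simp: K_def)
  qed
  have tr: "right_translations G \<subseteq> K"
  proof
    fix f assume "f \<in> right_translations G"
    then obtain a where a: "a \<in> carrier G" "f = translation a" by (auto simp: right_translations_eq)
    have "f x \<otimes> inv (f y) = x \<otimes> inv y \<otimes> ((x \<otimes> inv y) \<star> \<one>)"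
      if "x \<in> carrier G" "y \<in> carrier G" for x y
    proof -
      have "f x \<otimes> inv (f y) = x \<otimes> (a \<otimes> inv a) \<otimes> inv y"
        using a that by (simp add: translation_def inv_mult m_ac del: r_inv Units_r_inv)
      then show ?thesis using a that by simp
    qed
    then show "f \<in> K" using translation_Bij a unfolding K_def by blast
  qed
  have circ: "circle_translation a \<in> K" if a: "a \<in> carrier G" for a
  proof -
    have "circle_translation a x \<otimes> inv (circle_translation a y) = x \<otimes> inv y \<otimes> ((x \<otimes> inv y) \<star> a)"
      if c: "x \<in> carrier G" "y \<in> carrier G" for x y
    proof -
      have "circle_translation a x \<otimes> inv (circle_translation a y) =
          (a \<otimes> inv a) \<otimes> (x \<otimes> inv y \<otimes> ((x \<star> a) \<otimes> inv (y \<star> a)))"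
        using a c by (simp add: circle_translation_def inv_mult m_ac prd_comm [of a] del: r_inv Units_r_inv)
      then show ?thesis using a c by (simp add: prd_distr2 prd_inv2)
    qed
    then show ?thesis using RB a unfolding K_def by blast
  qed
  have hol: "K \<subseteq> holomorph G"
  proof
    fix f assume f: "f \<in> K"
    note fc [simp] = Kc [OF f]
    define g where "g x = f x \<otimes> inv x \<otimes> inv (f \<one>)" for x
    have "\<exists>e \<in> carrier G. g x \<otimes> inv (g y) = (x \<otimes> inv y) \<star> e"
      if c: "x \<in> carrier G" "y \<in> carrier G" for x y
    proof -
      obtain e where e: "e \<in> carrier G" "f x \<otimes> inv (f y) = x \<otimes> inv y \<otimes> ((x \<otimes> inv y) \<star> e)"
        using KD [OF f c] by blast
      define d where "d = x \<otimes> inv y"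
      have [simp]: "d \<in> carrier G" using c by (simp add: d_def)
      have "g x \<otimes> inv (g y) = (f x \<otimes> inv (f y)) \<otimes> inv (x \<otimes> inv y) \<otimes> (f \<one> \<otimes> inv (f \<one>))"
        using c by (simp add: g_def inv_mult m_ac del: r_inv Units_r_inv)
      also have "\<dots> = (d \<otimes> inv d) \<otimes> (d \<star> e) \<otimes> (f \<one> \<otimes> inv (f \<one>))"
        unfolding e(2) d_def [symmetric] using e(1) by (simp add: m_ac del: r_inv Units_r_inv)
      also have "\<dots> = (x \<otimes> inv y) \<star> e" using e(1) by (simp flip: d_def)
      finally show ?thesis using e(1) by blast
    qed
    moreover have "g \<one> = \<one>" by (simp add: g_def)
    moreover have "g \<in> carrier G \<rightarrow> carrier G" by (simp add: g_def)
    ultimately have g: "g (x \<otimes> y) = g x \<otimes> g y" if "x \<in> carrier G" "y \<in> carrier G" for x y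
      using rigid that by blast
    have fg: "f x = g x \<otimes> x \<otimes> f \<one>" if "x \<in> carrier G" for x
    proof -
      have "g x \<otimes> x \<otimes> f \<one> = f x \<otimes> (inv x \<otimes> x) \<otimes> (inv (f \<one>) \<otimes> f \<one>)"
        unfolding g_def using that by (simp add: m_ac del: l_inv Units_l_inv r_inv Units_r_inv)
      then show ?thesis using that by simp
    qed
    have gc: "g x \<in> carrier G" if "x \<in> carrier G" for x using that by (simp add: g_def)
    have "f (x \<otimes> y) \<otimes> f \<one> = f x \<otimes> f y" if "x \<in> carrier G" "y \<in> carrier G" for x y
      using fg [of "x \<otimes> y"] fg [of x] fg [of y] g that gc by (simp add: m_ac)
    then show "f \<in> holomorph G" using KB [OF f] by (simp add: holomorph_iff)
  qed
  have "G_transjugate G K" using NCI sub closed tr hol by (simp add: NCI2_group_def)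
  then have eq: "circle_translation ` carrier G = right_translations G"
    using transjugate_in_holomorph_iff [OF sub tr hol] R circ by blast
  obtain x y where c: "x \<in> carrier G" "y \<in> carrier G" "x \<star> y \<noteq> \<one>" using nontrivial by blast
  then have "circle_translation x \<in> right_translations G" using eq by blast
  then obtain b where b: "b \<in> carrier G" "circle_translation x = translation b"
    by (auto simp: right_translations_eq)
  have "x = b" using fun_cong [OF b(2), of \<one>] b(1) c by (simp add: circle_translation_def translation_def)
  then have "x \<otimes> y \<otimes> (x \<star> y) = x \<otimes> y"
    using fun_cong [OF b(2), of y] b(1) c by (simp add: circle_translation_def translation_def m_comm)
  then show False using c by simp
qed

end

text \<open>
  The invariance of \<open>q\<close> under shifts by its values gives \<open>q (q y) = 0\<close> and \<open>\<beta> x (q y) = 0\<close>. Since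
  the values of \<open>\<beta>\<close> are sums of values of \<open>q\<close> and their negatives, triple products vanish. It also makes
  \<open>x \<mapsto> x - q x\<close> the inverse of \<open>T x = x + q x\<close>, and \<open>T (x + y) = T x + T y + \<beta> x y\<close> with
  \<open>\<beta> x y = \<beta> (T x) (T y)\<close>.
\<close>

lemma (in comm_group) not_NCI2_group_if_quadratic_map:
  fixes q :: "'a \<Rightarrow> 'a"
  defines "\<beta> \<equiv> \<lambda>x y. q (x \<otimes> y) \<otimes> inv (q x) \<otimes> inv (q y)"
  assumes q_closed [simp]: "\<And>x. x \<in> carrier G \<Longrightarrow> q x \<in> carrier G"
    and shift: "\<And>x y. \<lbrakk>x \<in> carrier G; y \<in> carrier G\<rbrakk> \<Longrightarrow> q (x \<otimes> q y) = q x"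
    and biadditive: "\<And>x y z. \<lbrakk>x \<in> carrier G; y \<in> carrier G; z \<in> carrier G\<rbrakk> \<Longrightarrow>
      \<beta> x (y \<otimes> z) = \<beta> x y \<otimes> \<beta> x z"
    and nontrivial: "\<exists>x \<in> carrier G. \<exists>y \<in> carrier G. \<beta> x y \<noteq> \<one>"
    and rigid: "\<And>g x y. \<lbrakk>g \<in> carrier G \<rightarrow> carrier G; g \<one> = \<one>;
        \<And>x y. \<lbrakk>x \<in> carrier G; y \<in> carrier G\<rbrakk> \<Longrightarrow>
          \<exists>e \<in> carrier G. g x \<otimes> inv (g y) = \<beta> (x \<otimes> inv y) e;
        x \<in> carrier G; y \<in> carrier G\<rbrakk> \<Longrightarrow> g (x \<otimes> y) = g x \<otimes> g y"
  shows "\<not> NCI2_group G"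
proof -
  have \<beta>c [simp]: "\<beta> x y \<in> carrier G" if "x \<in> carrier G" "y \<in> carrier G" for x y
    using that by (simp add: \<beta>_def)
  have comm: "\<beta> x y = \<beta> y x" if "x \<in> carrier G" "y \<in> carrier G" for x y
    using that by (simp add: \<beta>_def m_ac)
  have q_mult: "q (x \<otimes> y) = q x \<otimes> q y \<otimes> \<beta> x y" if "x \<in> carrier G" "y \<in> carrier G" for x y
  proof -
    have "q x \<otimes> q y \<otimes> \<beta> x y = q (x \<otimes> y) \<otimes> (q x \<otimes> inv (q x)) \<otimes> (q y \<otimes> inv (q y))"
      using that by (simp add: \<beta>_def m_ac del: r_inv Units_r_inv)
    then show ?thesis using that by simp
  qed
  have \<beta>_one: "\<beta> x \<one> = \<one>" if "x \<in> carrier G" for x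
    using biadditive [of x \<one> \<one>] that by (metis \<beta>c l_cancel_one one_closed r_one)
  have q_one: "q \<one> = \<one>"
  proof -
    have "q \<one> \<otimes> q \<one> = q \<one>" using q_mult [of \<one> \<one>] \<beta>_one [of \<one>] by simp
    then show ?thesis using l_cancel_one [of "q \<one>" "q \<one>"] by simp
  qed
  have qq: "q (q y) = \<one>" if "y \<in> carrier G" for y
    using shift [of \<one> y] that q_one by simp
  have \<beta>_q: "\<beta> x (q y) = \<one>" if "x \<in> carrier G" "y \<in> carrier G" for x y
    using that by (simp add: \<beta>_def shift qq)
  have \<beta>_inv: "\<beta> x (inv y) = inv (\<beta> x y)" if "x \<in> carrier G" "y \<in> carrier G" for x y
    using biadditive [of x "inv y" y] that \<beta>_one by (intro inv_equality [symmetric]) simp_all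
  have \<beta>\<beta>: "\<beta> x (\<beta> y z) = \<one>" if "x \<in> carrier G" "y \<in> carrier G" "z \<in> carrier G" for x y z
  proof -
    have "\<beta> x (\<beta> y z) = \<beta> x (q (y \<otimes> z) \<otimes> inv (q y) \<otimes> inv (q z))"
      by (simp only: \<beta>_def)
    then show ?thesis using that by (simp add: biadditive \<beta>_inv \<beta>_q)
  qed
  interpret group_product G \<beta>
    by unfold_locales (simp_all add: comm biadditive \<beta>\<beta>)
  define T where "T x = x \<otimes> q x" for x
  have Tq: "q (T x) = q x" if "x \<in> carrier G" for x
    using that by (simp add: T_def shift)
  have Ti: "q (x \<otimes> inv (q x)) = q x" if "x \<in> carrier G" for x
    using shift [of "x \<otimes> inv (q x)" x] that by (simp add: m_assoc)
  have "bij_betw T (carrier G) (carrier G)"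
    by (rule bij_betw_byWitness [where f' = "\<lambda>x. x \<otimes> inv (q x)"])
      (auto simp: Tq Ti, auto simp: T_def Ti m_assoc)
  moreover have "T (x \<otimes> y) = T x \<otimes> T y \<otimes> \<beta> (T x) (T y)" if "x \<in> carrier G" "y \<in> carrier G" for x y
  proof -
    have "\<beta> (T x) (T y) = \<beta> x y"
      using that by (simp add: T_def prd_distr prd_distr2 \<beta>_q prd_comm [of "q x"])
    then show ?thesis using that by (simp add: T_def q_mult m_ac)
  qed
  moreover have "\<beta> (\<beta> x y) z = \<one>" if "x \<in> carrier G" "y \<in> carrier G" "z \<in> carrier G" for x y z
    using that by (simp add: comm [of "\<beta> x y"] \<beta>\<beta>)
  ultimately show ?thesis
    using not_NCI2_group_if_rigid [of T] nontrivial rigid by blast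
qed

section \<open>Groups that are not elementary abelian\<close>

context comm_group
begin

lemma adjoin_square_root:
  assumes N: "subgroup N G" and v: "v \<in> carrier G" "v \<otimes> v \<in> N"
  shows "subgroup {x \<in> carrier G. x \<in> N \<or> x \<otimes> v \<in> N} G" (is "subgroup ?N' G")
proof -
  interpret N: subgroup N G by (rule N)
  have vv: "inv (v \<otimes> v) \<in> N" using v by simp
  have mult: "x \<otimes> y \<in> N"
    if "x \<in> carrier G" "y \<in> carrier G" "x \<otimes> v \<in> N" "y \<otimes> v \<in> N" for x y
  proof -
    have "x \<otimes> y = (x \<otimes> v) \<otimes> (y \<otimes> v) \<otimes> inv (v \<otimes> v)"
      using that v by (intro inv_solve_right [THEN iffD2]) (simp_all add: m_ac)
    then show ?thesis using that vv by simp
  qed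
  have inv: "inv x \<otimes> v \<in> N" if "x \<in> carrier G" "x \<otimes> v \<in> N" for x
  proof -
    have "inv x \<otimes> v = inv (x \<otimes> v) \<otimes> (v \<otimes> v)"
    proof -
      have "inv (x \<otimes> v) \<otimes> (v \<otimes> v) = inv x \<otimes> (inv v \<otimes> v) \<otimes> v"
        using that v by (simp add: inv_mult m_ac del: l_inv Units_l_inv r_inv Units_r_inv)
      then show ?thesis using that v by simp
    qed
    then show ?thesis using that v by simp
  qed
  have mult1: "x \<otimes> y \<otimes> v \<in> N" if "x \<in> N" "y \<in> carrier G" "y \<otimes> v \<in> N" for x y
    using that v N.m_closed [of x "y \<otimes> v"] by (simp add: m_assoc)
  have mult2: "y \<otimes> x \<otimes> v \<in> N" if "x \<in> N" "y \<in> carrier G" "y \<otimes> v \<in> N" for x y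
    using mult1 [OF that] that by (simp add: m_comm)
  show ?thesis
  proof
    show "?N' \<subseteq> carrier G" by auto
    show "\<one> \<in> ?N'" by simp
    show "x \<otimes> y \<in> ?N'" if "x \<in> ?N'" "y \<in> ?N'" for x y
      using that mult mult1 mult2 by auto
    show "inv x \<in> ?N'" if "x \<in> ?N'" for x
      using that inv by auto
  qed
qed

text \<open>
  In a 2-group repeated squaring of \<open>x\<close> ends in the identity, hence enters \<open>N\<close>.
\<close>

lemma last_power_outside:
  assumes ord: "order G = 2 ^ m" and N: "subgroup N G" and x: "x \<in> carrier G" "x \<notin> N"
  obtains j :: nat where "x [^] (2 ^ j :: nat) \<notin> N" "x [^] (2 ^ j :: nat) \<otimes> x [^] (2 ^ j :: nat) \<in> N"
proof -
  let ?P = "\<lambda>j::nat. x [^] (2 ^ j :: nat) \<in> N"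
  have "?P m" using pow_order_eq_1 [OF x(1)] ord subgroup.one_closed [OF N] by simp
  moreover have "\<not> ?P 0" using x by simp
  ultimately obtain j where "\<not> ?P j" "?P (Suc j)"
    using nat_induct [of "\<lambda>j. \<not> ?P j" m] by blast
  moreover have "x [^] (2 ^ Suc j :: nat) = x [^] (2 ^ j :: nat) \<otimes> x [^] (2 ^ j :: nat)"
    using x by (simp add: nat_pow_mult mult_2)
  ultimately show thesis using that by metis
qed

text \<open>
  Choose a subgroup \<open>N\<close> maximal subject to \<open>G/N\<close> not being elementary, say \<open>2 g \<notin> N\<close>. For an
  involution \<open>v\<close> of \<open>G/N\<close> the quotient by \<open>v\<close> is elementary, so all doubles in \<open>G/N\<close> are \<open>0\<close> or
  \<open>v\<close>. Hence \<open>v = 2 g\<close> is the only involution, the double of every element is \<open>0\<close> or \<open>2 g\<close>, and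
  \<open>G/N\<close> is cyclic of order four, generated by \<open>g\<close>. The epimorphism sends \<open>x\<close> to the unique
  \<open>i < 4\<close> with \<open>x + i g \<in> N\<close>.
\<close>

lemma ex_epi_cyclic_four:
  assumes fin: "finite (carrier G)" and ord: "order G = 2 ^ m"
    and nonelementary: "\<exists>g \<in> carrier G. g \<otimes> g \<noteq> \<one>"
  shows "\<exists>\<chi>. \<chi> \<in> epi G (integer_mod_group 4)"
proof -
  define S where "S = {N. subgroup N G \<and> (\<exists>g \<in> carrier G. g \<otimes> g \<notin> N)}"
  have "S \<subseteq> Pow (carrier G)" by (auto simp: S_def dest: subgroup.subset)
  then have "finite S" using fin by (meson finite_Pow_iff finite_subset)
  moreover have "{\<one>} \<in> S" using nonelementary triv_subgroup by (auto simp: S_def)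
  ultimately obtain N where NS: "N \<in> S" and max: "\<And>N'. N' \<in> S \<Longrightarrow> N \<subseteq> N' \<Longrightarrow> N = N'"
    using finite_has_maximal [of S] by auto
  obtain g where sub: "subgroup N G" and g [simp]: "g \<in> carrier G" and gg: "g \<otimes> g \<notin> N"
    using NS by (auto simp: S_def)
  interpret N: subgroup N G by (rule sub)
  have adjoin: "x \<otimes> x \<in> N \<or> x \<otimes> x \<otimes> v \<in> N"
    if v: "v \<in> carrier G" "v \<notin> N" "v \<otimes> v \<in> N" and x: "x \<in> carrier G" for v x
  proof -
    let ?N' = "{x \<in> carrier G. x \<in> N \<or> x \<otimes> v \<in> N}"
    have "N \<subseteq> ?N'" using N.subset by auto
    moreover have "v \<in> ?N'" using v by simp
    ultimately have "?N' \<notin> S" using max v by blast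
    then show ?thesis using adjoin_square_root [OF sub v(1,3)] x by (auto simp: S_def)
  qed
  have cancel: "x \<in> N" if "x \<otimes> y \<in> N" "y \<in> N" "x \<in> carrier G" for x y
  proof -
    have "x = (x \<otimes> y) \<otimes> inv y" using that by (simp add: m_assoc)
    then show ?thesis using that by (metis N.m_closed N.m_inv_closed)
  qed
  obtain w where w [simp]: "w \<in> carrier G" and wN: "w \<notin> N" "w \<otimes> w \<in> N"
    using last_power_outside [OF ord sub _ gg] by (metis g m_closed nat_pow_closed)
  have ggw: "g \<otimes> g \<otimes> w \<in> N" using adjoin [OF w wN g] gg by blast
  have swap: "u \<otimes> (g \<otimes> g) \<in> N" if "u \<otimes> w \<in> N" and [simp]: "u \<in> carrier G" for u
  proof (rule cancel)
    have "u \<otimes> (g \<otimes> g) \<otimes> (w \<otimes> w) = (u \<otimes> w) \<otimes> (g \<otimes> g \<otimes> w)" by (simp add: m_ac)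
    then show "u \<otimes> (g \<otimes> g) \<otimes> (w \<otimes> w) \<in> N" using that ggw by simp
  qed (use wN in auto)
  have g4: "g [^] (4::nat) \<in> N"
    using swap [OF ggw] by (simp add: eval_nat_numeral m_assoc)
  have root: "v \<in> N \<or> v \<otimes> (g \<otimes> g) \<in> N" if "v \<otimes> v \<in> N" "v \<in> carrier G" for v
    using adjoin [of v g] that gg by (auto simp: m_comm)
  have cosets: "\<exists>i::nat. i < 4 \<and> x \<otimes> g [^] i \<in> N" if x [simp]: "x \<in> carrier G" for x
  proof -
    consider "x \<otimes> x \<in> N" | "(x \<otimes> g) \<otimes> (x \<otimes> g) \<in> N"
      using adjoin [OF w wN x] swap [of "x \<otimes> x"] by (auto simp: m_ac)
    then have "x \<otimes> g [^] (0::nat) \<in> N \<or> x \<otimes> g [^] (2::nat) \<in> N \<or>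
        x \<otimes> g [^] (1::nat) \<in> N \<or> x \<otimes> g [^] (3::nat) \<in> N"
    proof cases
      case 1 then show ?thesis using root [of x] by (auto simp: eval_nat_numeral m_assoc)
    next
      case 2 then show ?thesis using root [of "x \<otimes> g"] by (auto simp: eval_nat_numeral m_assoc)
    qed
    then show ?thesis by (metis one_less_numeral_iff semiring_norm(76) zero_less_numeral
        numeral_less_iff semiring_norm(78) semiring_norm(80,81))
  qed
  have g_notin: "g [^] i \<notin> N" if "0 < i" "i < 4" for i :: nat
  proof
    assume i: "g [^] i \<in> N"
    have "g \<notin> N" using gg by auto
    moreover have "g [^] (2::nat) \<notin> N" using gg by (simp add: eval_nat_numeral)
    moreover have "g [^] (3::nat) \<notin> N"
    proof
      assume "g [^] (3::nat) \<in> N"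
      moreover have "g \<otimes> g [^] (3::nat) = g [^] (4::nat)" by (simp add: eval_nat_numeral m_ac)
      ultimately have "g \<in> N" using g4 cancel [of g "g [^] (3::nat)"] by simp
      then show False using gg by auto
    qed
    moreover have "i = 1 \<or> i = 2 \<or> i = 3" using that by auto
    ultimately show False using i by auto
  qed
  have uniq: "i = j"
    if "x \<in> carrier G" "x \<otimes> g [^] i \<in> N" "x \<otimes> g [^] j \<in> N" "i < 4" "j < 4" for x and i j :: nat
    using that
  proof (induction i j rule: linorder_wlog)
    case (le i j)
    have "g [^] (j - i) \<otimes> (x \<otimes> g [^] i) = x \<otimes> (g [^] (j - i) \<otimes> g [^] i)" using le by (simp add: m_ac)
    also have "\<dots> = x \<otimes> g [^] j" using le by (simp add: nat_pow_mult)
    finally have "g [^] (j - i) \<otimes> (x \<otimes> g [^] i) \<in> N" using le by simp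
    then have "g [^] (j - i) \<in> N" by (rule cancel) (use le in auto)
    then show ?case using g_notin [of "j - i"] le by (cases "i = j") auto
  qed auto
  define \<chi> where "\<chi> x = (THE i::nat. i < 4 \<and> x \<otimes> g [^] i \<in> N)" for x
  have \<chi>I: "\<chi> x = i" if "x \<in> carrier G" "x \<otimes> g [^] i \<in> N" "i < 4" for x i
    unfolding \<chi>_def using that uniq by (intro the_equality) blast+
  have \<chi>: "\<chi> x < 4" "x \<otimes> g [^] \<chi> x \<in> N" if "x \<in> carrier G" for x
    using cosets [OF that] \<chi>I [OF that] by auto
  have "\<chi> (x \<otimes> y) = (\<chi> x + \<chi> y) mod 4" if [simp]: "x \<in> carrier G" "y \<in> carrier G" for x y
  proof (rule \<chi>I)
    define n where "n = \<chi> x + \<chi> y"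
    have "g [^] n = g [^] (n mod 4) \<otimes> (g [^] (4::nat)) [^] (n div 4)"
      by (simp add: nat_pow_pow nat_pow_mult)
    moreover have "x \<otimes> y \<otimes> g [^] n = (x \<otimes> g [^] \<chi> x) \<otimes> (y \<otimes> g [^] \<chi> y)"
      by (simp add: n_def m_ac flip: nat_pow_mult)
    ultimately have "x \<otimes> y \<otimes> g [^] (n mod 4) \<otimes> (g [^] (4::nat)) [^] (n div 4) =
        (x \<otimes> g [^] \<chi> x) \<otimes> (y \<otimes> g [^] \<chi> y)"
      by (simp add: m_assoc)
    then have "x \<otimes> y \<otimes> g [^] (n mod 4) \<otimes> (g [^] (4::nat)) [^] (n div 4) \<in> N"
      using \<chi>(2) [of x] \<chi>(2) [of y] by simp
    moreover have "(g [^] (4::nat)) [^] i \<in> N" for i :: nat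
      by (induction i) (use g4 in simp_all)
    ultimately have "x \<otimes> y \<otimes> g [^] (n mod 4) \<in> N"
      by (rule cancel) simp
    then show "x \<otimes> y \<otimes> g [^] ((\<chi> x + \<chi> y) mod 4) \<in> N"
      by (simp add: n_def)
  qed auto
  then have "(\<lambda>x. int (\<chi> x)) \<in> hom G (integer_mod_group 4)"
    using \<chi>(1) by (auto simp: hom_def carrier_integer_mod_group zmod_int)
  moreover have "(\<lambda>x. int (\<chi> x)) ` carrier G = carrier (integer_mod_group 4)"
  proof (intro equalityI subsetI)
    fix i assume "i \<in> carrier (integer_mod_group 4)"
    then obtain j :: nat where j: "i = int j" "j < 4"
      by (auto simp: carrier_integer_mod_group elim: nonneg_int_cases)
    have "\<chi> (inv (g [^] j)) = j" using j by (intro \<chi>I) auto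
    then show "i \<in> (\<lambda>x. int (\<chi> x)) ` carrier G" using j by (intro image_eqI [of _ _ "inv (g [^] j)"]) simp_all
  qed (use \<chi>(1) in \<open>auto simp: carrier_integer_mod_group\<close>)
  ultimately show ?thesis by (auto simp: epi_def)
qed

text \<open>
  The map \<open>q\<close> multiplies \<open>w\<close> by the binomial coefficient \<open>\<chi> x\<close> choose \<open>2\<close>, which modulo two is a
  quadratic function on \<open>C\<^sub>4\<close>. Its polarisation is \<open>w\<close> if \<open>\<chi> x\<close> and \<open>\<chi> y\<close> are both odd, and \<open>0\<close>
  otherwise. A map \<open>g\<close> as in the rigidity condition depends only on the parity of \<open>\<chi>\<close> and takes values
  in \<open>{0, w}\<close>, so it is a homomorphism.
\<close>

lemma not_NCI2_group_if_epi_cyclic_four: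
  assumes \<chi>: "\<chi> \<in> epi G (integer_mod_group 4)"
    and w: "w \<in> carrier G" "w \<noteq> \<one>" "w \<otimes> w = \<one>" "\<chi> w = 0"
  shows "\<not> NCI2_group G"
proof -
  have hom: "\<chi> (x \<otimes> y) = (\<chi> x + \<chi> y) mod 4" if "x \<in> carrier G" "y \<in> carrier G" for x y
    using \<chi> that by (auto simp: epi_def hom_def)
  have range: "0 \<le> \<chi> x" "\<chi> x < 4" if "x \<in> carrier G" for x
    using \<chi> that by (auto simp: epi_def hom_def carrier_integer_mod_group Pi_iff)
  have \<chi>_one: "\<chi> \<one> = 0" using hom [of \<one> \<one>] range [of \<one>] by simp presburger
  note [simp] = w(1,3)
  have [simp]: "inv w = w" using w by (simp add: inv_equality)
  define q where "q x = (if \<chi> x < 2 then \<one> else w)" for x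
  define P where "P x = odd (\<chi> x)" for x
  have P_mult: "P (x \<otimes> y) = (P x \<noteq> P y)" if "x \<in> carrier G" "y \<in> carrier G" for x y
  proof -
    have "even ((\<chi> x + \<chi> y) mod 4) = even (\<chi> x + \<chi> y)" by presburger
    then show ?thesis using that by (simp add: P_def hom)
  qed
  have P_one: "\<not> P \<one>" using P_mult [of \<one> \<one>] by simp
  have P_inv: "P (inv x) = P x" if "x \<in> carrier G" for x
    using P_mult [of x "inv x"] that P_one by simp
  have \<beta>: "q (x \<otimes> y) \<otimes> inv (q x) \<otimes> inv (q y) = (if P x \<and> P y then w else \<one>)"
    if [simp]: "x \<in> carrier G" "y \<in> carrier G" for x y
  proof -
    have "\<chi> x = 0 \<or> \<chi> x = 1 \<or> \<chi> x = 2 \<or> \<chi> x = 3" "\<chi> y = 0 \<or> \<chi> y = 1 \<or> \<chi> y = 2 \<or> \<chi> y = 3"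
      using range [of x] range [of y] by auto
    then show ?thesis by (elim disjE) (simp_all add: q_def hom P_def)
  qed
  show ?thesis
  proof (rule not_NCI2_group_if_quadratic_map [of q])
    show "q x \<in> carrier G" if "x \<in> carrier G" for x by (simp add: q_def)
    show "q (x \<otimes> q y) = q x" if "x \<in> carrier G" "y \<in> carrier G" for x y
      using that w hom range [of x] \<chi>_one by (auto simp: q_def)
    show "q (x \<otimes> (y \<otimes> z)) \<otimes> inv (q x) \<otimes> inv (q (y \<otimes> z)) =
        q (x \<otimes> y) \<otimes> inv (q x) \<otimes> inv (q y) \<otimes> (q (x \<otimes> z) \<otimes> inv (q x) \<otimes> inv (q z))"
      if "x \<in> carrier G" "y \<in> carrier G" "z \<in> carrier G" for x y z
      using that by (simp add: \<beta> P_mult)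
    have "1 \<in> \<chi> ` carrier G" using \<chi> by (auto simp: epi_def carrier_integer_mod_group)
    then obtain u where "u \<in> carrier G" "P u" by (auto simp: P_def)
    then show "\<exists>x \<in> carrier G. \<exists>y \<in> carrier G. q (x \<otimes> y) \<otimes> inv (q x) \<otimes> inv (q y) \<noteq> \<one>"
      using \<beta> w(2) by (intro bexI [of _ u]) auto
    fix g x y
    assume g: "g \<in> carrier G \<rightarrow> carrier G" "g \<one> = \<one>"
      and rigid: "\<And>x y. \<lbrakk>x \<in> carrier G; y \<in> carrier G\<rbrakk> \<Longrightarrow>
        \<exists>e \<in> carrier G. g x \<otimes> inv (g y) = q (x \<otimes> inv y \<otimes> e) \<otimes> inv (q (x \<otimes> inv y)) \<otimes> inv (q e)"
      and c: "x \<in> carrier G" "y \<in> carrier G"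
    have gc [simp]: "g u \<in> carrier G" if "u \<in> carrier G" for u using g that by blast
    have diff: "\<exists>e \<in> carrier G. g u \<otimes> inv (g v) = (if P (u \<otimes> inv v) \<and> P e then w else \<one>)"
      if uv: "u \<in> carrier G" "v \<in> carrier G" for u v
    proof -
      obtain e where e: "e \<in> carrier G"
        "g u \<otimes> inv (g v) = q (u \<otimes> inv v \<otimes> e) \<otimes> inv (q (u \<otimes> inv v)) \<otimes> inv (q e)"
        using rigid [OF uv] by blast
      have "u \<otimes> inv v \<in> carrier G" using uv by simp
      from e(2) [unfolded \<beta> [OF this e(1)]] show ?thesis using e(1) by blast
    qed
    have same: "g u = g v" if uv: "u \<in> carrier G" "v \<in> carrier G" "P u = P v" for u v
    proof -
      obtain e where "e \<in> carrier G" "g u \<otimes> inv (g v) = (if P (u \<otimes> inv v) \<and> P e then w else \<one>)"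
        using diff [OF uv(1,2)] by auto
      then have "g u \<otimes> inv (g v) = \<one>" using uv by (simp add: P_mult P_inv)
      then show ?thesis using inv_equality [of "g u" "inv (g v)"] uv by simp
    qed
    have two_values: "g u \<in> {\<one>, w}" if "u \<in> carrier G" for u
      using diff [OF that one_closed] that g(2) by (auto split: if_splits)
    show "g (x \<otimes> y) = g x \<otimes> g y"
    proof (cases "P y")
      case False
      then have "g y = \<one>" "g (x \<otimes> y) = g x" using same [of y \<one>] same [of "x \<otimes> y" x] c P_one P_mult g(2) by simp_all
      then show ?thesis using c by simp
    next
      case True
      show ?thesis
      proof (cases "P x")
        case False
        then have "g x = \<one>" "g (x \<otimes> y) = g y" using same [of x \<one>] same [of "x \<otimes> y" y] c P_one P_mult g(2) by simp_all
        then show ?thesis using c by simp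
      next
        case Px: True
        then have "g x = g y" "g (x \<otimes> y) = \<one>"
          using same [of x y] same [of "x \<otimes> y" \<one>] c P_one P_mult g(2) True by simp_all
        then show ?thesis using two_values [OF c(2)] by (metis insertE singletonD r_one one_closed w(3))
      qed
    qed
  qed
qed

end

lemma (in comm_group) cyclic_four_or_not_NCI2_group:
  assumes fin: "finite (carrier G)" and ord: "order G = 2 ^ m"
    and nonelementary: "\<exists>g \<in> carrier G. g \<otimes> g \<noteq> \<one>"
  shows "G \<cong> integer_mod_group 4 \<or> \<not> NCI2_group G"
proof -
  obtain \<chi> where \<chi>: "\<chi> \<in> epi G (integer_mod_group 4)"
    using ex_epi_cyclic_four [OF assms] by blast
  then interpret \<chi>: group_hom G "integer_mod_group 4" \<chi>
    by (simp add: group_hom_def group_hom_axioms_def epi_def)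
  show ?thesis
  proof (cases "\<exists>x \<in> carrier G. x \<noteq> \<one> \<and> \<chi> x = 0")
    case True
    then obtain x where x: "x \<in> carrier G" "x \<noteq> \<one>" "\<chi> x = 0" by blast
    obtain j :: nat where j: "x [^] (2 ^ j :: nat) \<notin> {\<one>}"
      "x [^] (2 ^ j :: nat) \<otimes> x [^] (2 ^ j :: nat) \<in> {\<one>}"
      using last_power_outside [OF ord triv_subgroup x(1)] x(2) by blast
    have "\<chi> (x [^] (2 ^ j :: nat)) = 0" using \<chi>.hom_nat_pow [OF x(1)] x(3) by simp
    then show ?thesis
      using not_NCI2_group_if_epi_cyclic_four [OF \<chi>, of "x [^] (2 ^ j :: nat)"] j x(1) by simp
  next
    case False
    then have "inj_on \<chi> (carrier G)"
      by (auto simp: \<chi>.inj_on_one_iff)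
    then have "\<chi> \<in> iso G (integer_mod_group 4)"
      using \<chi> by (simp add: iso_def epi_def bij_betw_def)
    then show ?thesis by (simp add: is_isoI)
  qed
qed

section \<open>Elementary abelian groups of rank at least six\<close>

text \<open>
  Vectors over the field with two elements are predicates on indices, added by exclusive or. Indices
  \<open>0, 1, 2\<close> carry a vector of the three-dimensional space, and indices \<open>3, 4, 5\<close> carry values in a
  second copy of it. So \<open>cross\<close> maps pairs of vectors of the first copy to the second copy, \<open>minors\<close> is the
  quadratic map with polarisation \<open>cross\<close>, and \<open>dot\<close> pairs the second copy with the first.
\<close>

definition cross :: "(nat \<Rightarrow> bool) \<Rightarrow> (nat \<Rightarrow> bool) \<Rightarrow> nat \<Rightarrow> bool"
  where "cross a b i \<longleftrightarrow>
    i = 3 \<and> (a 1 \<and> b 2) \<noteq> (a 2 \<and> b 1) \<or>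
    i = 4 \<and> (a 0 \<and> b 2) \<noteq> (a 2 \<and> b 0) \<or>
    i = 5 \<and> (a 0 \<and> b 1) \<noteq> (a 1 \<and> b 0)"

definition minors :: "(nat \<Rightarrow> bool) \<Rightarrow> nat \<Rightarrow> bool"
  where "minors a i \<longleftrightarrow> i = 3 \<and> a 1 \<and> a 2 \<or> i = 4 \<and> a 0 \<and> a 2 \<or> i = 5 \<and> a 0 \<and> a 1"

definition dot :: "(nat \<Rightarrow> bool) \<Rightarrow> (nat \<Rightarrow> bool) \<Rightarrow> bool"
  where "dot p a \<longleftrightarrow> (((p 3 \<and> a 0) \<noteq> (p 4 \<and> a 1)) \<noteq> (p 5 \<and> a 2))"

lemma minors_polarisation:
  "((minors (\<lambda>i. a i \<noteq> b i) i \<noteq> minors a i) \<noteq> minors b i) = cross a b i"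
  unfolding minors_def cross_def by (cases "i = 3"; cases "i = 4"; cases "i = 5") auto

lemma cross_additive: "cross a (\<lambda>i. b i \<noteq> c i) i = (cross a b i \<noteq> cross a c i)"
  unfolding cross_def by (cases "i = 3"; cases "i = 4"; cases "i = 5") auto

lemma dot_additive: 
  "dot p (\<lambda>i. a i \<noteq> b i) = (dot p a \<noteq> dot p b)" 
  "dot (\<lambda>i. p i \<noteq> q i) a = (dot p a \<noteq> dot q a)" 
  unfolding dot_def by auto

lemma minors_shift: "minors (\<lambda>i. a i \<noteq> minors b i) = minors a"
  unfolding minors_def by (intro ext) auto

lemma dot_cross: "\<not> dot (cross a b) a"
  unfolding dot_def cross_def by auto

context comm_group
begin

text \<open>
  An isomorphism from \<open>H\<close> to the vectors over the field with two elements that are supported on the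
  indices below \<open>k\<close>. Letting \<open>c x\<close> be a total predicate that is false from \<open>k\<close> on allows vectors of
  different length to be added and compared as functions.
\<close>

definition binary_coordinates :: "nat \<Rightarrow> ('a \<Rightarrow> nat \<Rightarrow> bool) \<Rightarrow> 'a set \<Rightarrow> bool"
  where "binary_coordinates k c H \<longleftrightarrow>
    bij_betw c H {s. \<forall>i \<ge> k. \<not> s i} \<and>
    (\<forall>x \<in> H. \<forall>y \<in> H. c (x \<otimes> y) = (\<lambda>i. c x i \<noteq> c y i))"

text \<open>
  The new coordinate tells on which side of \<open>H\<close> an element lies; \<open>r\<close> moves it back to \<open>H\<close>.
\<close>

lemma extend_binary_coordinates:
  assumes exp2: "\<And>x. x \<in> carrier G \<Longrightarrow> x \<otimes> x = \<one>"
    and H: "subgroup H G" and c: "binary_coordinates k c H"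
    and v: "v \<in> carrier G" "v \<notin> H"
  shows "\<exists>c'. binary_coordinates (Suc k) c' {x \<in> carrier G. x \<in> H \<or> x \<otimes> v \<in> H}"
proof -
  interpret H: subgroup H G by (rule H)
  have twice: "x \<otimes> (x \<otimes> y) = y" if "x \<in> carrier G" "y \<in> carrier G" for x y
    using that exp2 by (simp flip: m_assoc)
  let ?H' = "{x \<in> carrier G. x \<in> H \<or> x \<otimes> v \<in> H}"
  define r where "r x = (if x \<in> H then x else x \<otimes> v)" for x
  define c' where "c' x = (\<lambda>i. if i = k then x \<notin> H else c (r x) i)" for x
  have rH: "r x \<in> H" if "x \<in> ?H'" for x using that by (auto simp: r_def)
  have left: "x \<in> H" if "x \<otimes> y \<in> H" "y \<in> H" "x \<in> carrier G" for x y
  proof -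
    have "(x \<otimes> y) \<otimes> y = x" using that exp2 by (simp add: m_assoc)
    then show ?thesis using H.m_closed [OF that(1,2)] by simp
  qed
  have right: "y \<in> H" if "x \<otimes> y \<in> H" "x \<in> H" "y \<in> carrier G" for x y
    using left [of y x] that by (simp add: m_comm)
  have both: "x \<otimes> y \<in> H" if xy: "x \<in> ?H'" "y \<in> ?H'" "x \<notin> H" "y \<notin> H" for x y
  proof -
    have "(x \<otimes> v) \<otimes> (y \<otimes> v) = x \<otimes> y" using xy v twice by (simp add: m_ac)
    moreover have "x \<otimes> v \<in> H" "y \<otimes> v \<in> H" using xy by auto
    ultimately show ?thesis using H.m_closed by metis
  qed
  have mem: "x \<otimes> y \<in> H \<longleftrightarrow> (x \<in> H \<longleftrightarrow> y \<in> H)" if "x \<in> ?H'" "y \<in> ?H'" for x y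
    using that left [of x y] right [of x y] both [OF that] H.m_closed [of x y] by blast
  have r_mult: "r (x \<otimes> y) = r x \<otimes> r y" if xy: "x \<in> ?H'" "y \<in> ?H'" for x y
    using xy v mem [OF xy] twice by (auto simp: r_def m_ac)
  have c_bij: "bij_betw c H {s. \<forall>i \<ge> k. \<not> s i}" using c by (simp add: binary_coordinates_def)
  have "c' (x \<otimes> y) = (\<lambda>i. c' x i \<noteq> c' y i)" if xy: "x \<in> ?H'" "y \<in> ?H'" for x y
  proof -
    have "c (r (x \<otimes> y)) = (\<lambda>i. c (r x) i \<noteq> c (r y) i)"
      unfolding r_mult [OF xy] using c rH [OF xy(1)] rH [OF xy(2)] by (simp add: binary_coordinates_def)
    then show ?thesis using mem [OF xy] by (auto simp: c'_def)
  qed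
  moreover have "bij_betw c' ?H' {s. \<forall>i \<ge> Suc k. \<not> s i}"
    unfolding bij_betw_def
  proof
    show "inj_on c' ?H'"
    proof
      fix x y assume x: "x \<in> ?H'" and y: "y \<in> ?H'" and eq: "c' x = c' y"
      have xy: "x \<in> H \<longleftrightarrow> y \<in> H" using fun_cong [OF eq, of k] by (simp add: c'_def)
      have ck: "\<not> c (r z) k" if "z \<in> ?H'" for z
        using bij_betwE [OF c_bij] rH [OF that] by auto
      have "c (r x) = c (r y)"
      proof
        fix i show "c (r x) i = c (r y) i"
          using fun_cong [OF eq, of i] ck [OF x] ck [OF y] by (cases "i = k") (auto simp: c'_def)
      qed
      then have "r x = r y"
        using bij_betw_imp_inj_on [OF c_bij] rH [OF x] rH [OF y] by (simp add: inj_on_eq_iff)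
      then show "x = y" using x y xy v by (auto simp: r_def split: if_splits)
    qed
    show "c' ` ?H' = {s. \<forall>i \<ge> Suc k. \<not> s i}"
    proof (intro equalityI subsetI)
      fix s assume "s \<in> c' ` ?H'"
      then obtain x where x: "x \<in> ?H'" "s = c' x" by blast
      have "\<forall>i \<ge> k. \<not> c (r x) i" using bij_betwE [OF c_bij] rH [OF x(1)] by blast
      then show "s \<in> {s. \<forall>i \<ge> Suc k. \<not> s i}" by (simp add: x(2) c'_def)
    next
      fix s assume s: "s \<in> {s. \<forall>i \<ge> Suc k. \<not> s i}"
      have "\<not> (s (k := False)) i" if "k \<le> i" for i
        using s that by (cases "i = k") simp_all
      then have "s (k := False) \<in> {s. \<forall>i \<ge> k. \<not> s i}" by blast
      then obtain u where u: "u \<in> H" "c u = s (k := False)"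
        using bij_betw_imp_surj_on [OF c_bij] by (metis imageE)
      define x where "x = (if s k then u \<otimes> v else u)"
      have "u \<otimes> v \<notin> H" using right [of u v] u(1) v by blast
      then have x: "x \<in> H \<longleftrightarrow> \<not> s k" "x \<in> ?H'" "r x = u"
        using u(1) v exp2 by (auto simp: x_def r_def m_assoc)
      have "c' x = s" by (rule ext) (simp add: c'_def x u)
      then show "s \<in> c' ` ?H'" using x(2) by blast
    qed
  qed
  ultimately show ?thesis unfolding binary_coordinates_def by blast
qed

lemma ex_binary_coordinates:
  assumes fin: "finite (carrier G)" and exp2: "\<And>x. x \<in> carrier G \<Longrightarrow> x \<otimes> x = \<one>"
  shows "\<exists>k c. binary_coordinates k c (carrier G)"
proof -
  define S where "S = {H. subgroup H G \<and> (\<exists>k c. binary_coordinates k c H)}"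
  have "S \<subseteq> Pow (carrier G)" by (auto simp: S_def dest: subgroup.subset)
  then have "finite S" using fin by (meson finite_Pow_iff finite_subset)
  moreover have "binary_coordinates 0 (\<lambda>_ _. False) {\<one>}"
    by (auto simp: binary_coordinates_def bij_betw_def)
  then have "{\<one>} \<in> S" using triv_subgroup by (auto simp: S_def)
  ultimately obtain H where HS: "H \<in> S" and max: "\<And>H'. H' \<in> S \<Longrightarrow> H \<subseteq> H' \<Longrightarrow> H = H'"
    using finite_has_maximal [of S] by auto
  obtain k c where H: "subgroup H G" "binary_coordinates k c H" using HS by (auto simp: S_def)
  have "carrier G \<subseteq> H"
  proof
    fix v assume v: "v \<in> carrier G"
    show "v \<in> H"
    proof (rule ccontr)
      assume vH: "v \<notin> H"
      let ?H' = "{x \<in> carrier G. x \<in> H \<or> x \<otimes> v \<in> H}"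
      have "subgroup ?H' G"
        using adjoin_square_root [OF H(1) v] exp2 [OF v] subgroup.one_closed [OF H(1)] by simp
      then have "?H' \<in> S" using extend_binary_coordinates [OF exp2 H v vH] by (auto simp: S_def)
      moreover have "H \<subseteq> ?H'" using subgroup.subset [OF H(1)] by auto
      moreover have "v \<in> ?H'" using exp2 [OF v] v subgroup.one_closed [OF H(1)] by simp
      ultimately show False using max vH by blast
    qed
  qed
  then have "H = carrier G" using subgroup.subset [OF H(1)] by blast
  then show ?thesis using H(2) by blast
qed

lemma iso_cyclic_power_two_if_binary_coordinates:
  assumes c: "binary_coordinates k c (carrier G)"
  shows "G \<cong> cyclic_power 2 k"
proof -
  have c_bij: "bij_betw c (carrier G) {s. \<forall>i \<ge> k. \<not> s i}" using c by (simp add: binary_coordinates_def)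
  define h where "h x = (\<lambda>i \<in> {..<k}. if c x i then 1 else 0 :: int)" for x
  have carr: "carrier (cyclic_power 2 k) = (\<Pi>\<^sub>E i\<in>{..<k}. {0, 1})"
    by (simp add: carrier_integer_mod_group) (intro PiE_cong, auto)
  have "h \<in> hom G (cyclic_power 2 k)"
    unfolding hom_def carr using c
    by (auto simp: h_def binary_coordinates_def PiE_iff intro!: restrict_ext)
  moreover have "bij_betw h (carrier G) (carrier (cyclic_power 2 k))"
    unfolding bij_betw_def
  proof
    show "inj_on h (carrier G)"
    proof
      fix x y assume xy: "x \<in> carrier G" "y \<in> carrier G" "h x = h y"
      have "c x = c y"
      proof
        fix i show "c x i = c y i"
          using fun_cong [OF xy(3), of i] bij_betwE [OF c_bij] xy(1,2)
          by (cases "i < k") (auto simp: h_def split: if_splits)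
      qed
      then show "x = y" using xy bij_betw_imp_inj_on [OF c_bij] by (simp add: inj_on_eq_iff)
    qed
    show "h ` carrier G = carrier (cyclic_power 2 k)"
    proof (intro equalityI subsetI)
      fix f assume f: "f \<in> carrier (cyclic_power 2 k)"
      have "(\<lambda>i. i < k \<and> f i = 1) \<in> c ` carrier G"
        using bij_betw_imp_surj_on [OF c_bij] by simp
      then obtain x where x: "x \<in> carrier G" "c x = (\<lambda>i. i < k \<and> f i = 1)" by auto
      have "h x = f"
      proof
        fix i show "h x i = f i"
          using f x unfolding carr by (cases "i < k") (auto simp: h_def PiE_iff extensional_def)
      qed
      then show "f \<in> h ` carrier G" using x by blast
    qed (use calculation in \<open>auto simp: hom_def\<close>)
  qed
  ultimately show ?thesis by (auto intro!: is_isoI simp: iso_def)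
qed

text \<open>
  Let \<open>g\<close> be as in the rigidity condition, and let \<open>\<gamma> x\<close> and \<open>\<phi> x\<close> be the coordinate vectors of
  \<open>g x\<close> and \<open>x\<close> in the two three-dimensional spaces. As \<open>u \<times> v\<close> is orthogonal to \<open>u\<close>, the difference
  \<open>\<gamma> x - \<gamma> y\<close> is orthogonal to \<open>\<phi> x - \<phi> y\<close>. With \<open>y = 0\<close> this says that \<open>\<gamma> x\<close> is orthogonal to
  \<open>\<phi> x\<close>, and expanding the general case gives \<open>\<gamma> x \<bullet> \<phi> y = \<gamma> y \<bullet> \<phi> x\<close>. The right-hand side
  is additive in \<open>x\<close>, so \<open>\<gamma>\<close> is additive, since \<open>\<phi> y\<close> runs through all vectors.
\<close>

lemma not_NCI2_group_if_six_coordinates: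
  assumes coord: "binary_coordinates k c (carrier G)" and k: "6 \<le> k"
  shows "\<not> NCI2_group G"
proof -
  have c_bij: "bij_betw c (carrier G) {s. \<forall>i \<ge> k. \<not> s i}"
    and c_mult [simp]: "\<And>x y. \<lbrakk>x \<in> carrier G; y \<in> carrier G\<rbrakk> \<Longrightarrow> c (x \<otimes> y) = (\<lambda>i. c x i \<noteq> c y i)"
    using coord by (simp_all add: binary_coordinates_def)
  have eqI: "x = y" if "c x = c y" "x \<in> carrier G" "y \<in> carrier G" for x y
    using that bij_betw_imp_inj_on [OF c_bij] by (simp add: inj_on_eq_iff)
  have c_one [simp]: "c \<one> = (\<lambda>i. False)"
    using fun_cong [OF c_mult [of \<one> \<one>]] by auto
  have c_inv [simp]: "c (inv x) = c x" if "x \<in> carrier G" for x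
    using fun_cong [OF c_mult [of x "inv x"]] that by auto
  have ex: "\<exists>x \<in> carrier G. c x = s" if "\<forall>i \<ge> k. \<not> s i" for s
  proof -
    have "s \<in> c ` carrier G" using bij_betw_imp_surj_on [OF c_bij] that by simp
    then show ?thesis by auto
  qed
  define q where "q x = inv_into (carrier G) c (minors (c x))" for x
  have minors: "minors (c x) \<in> c ` carrier G" for x
    using k unfolding bij_betw_imp_surj_on [OF c_bij] by (auto simp: minors_def)
  have q_closed [simp]: "q x \<in> carrier G" for x
    using inv_into_into [OF minors] by (simp add: q_def)
  have c_q [simp]: "c (q x) = minors (c x)" for x
    using f_inv_into_f [OF minors] by (simp add: q_def)
  have c_\<beta>: "c (q (x \<otimes> y) \<otimes> inv (q x) \<otimes> inv (q y)) = cross (c x) (c y)"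
    if "x \<in> carrier G" "y \<in> carrier G" for x y
    using that by (simp add: fun_eq_iff flip: minors_polarisation)
  show ?thesis
  proof (rule not_NCI2_group_if_quadratic_map [of q])
    show "q x \<in> carrier G" if "x \<in> carrier G" for x by simp
    show "q (x \<otimes> q y) = q x" if "x \<in> carrier G" "y \<in> carrier G" for x y
      using that by (intro eqI) (simp_all add: minors_shift [simplified])
    show "q (x \<otimes> (y \<otimes> z)) \<otimes> inv (q x) \<otimes> inv (q (y \<otimes> z)) =
        q (x \<otimes> y) \<otimes> inv (q x) \<otimes> inv (q y) \<otimes> (q (x \<otimes> z) \<otimes> inv (q x) \<otimes> inv (q z))"
      (is "?l = ?r1 \<otimes> ?r2")
      if xyz: "x \<in> carrier G" "y \<in> carrier G" "z \<in> carrier G" for x y z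
    proof (rule eqI)
      have "c ?l = cross (c x) (\<lambda>i. c y i \<noteq> c z i)" using c_\<beta> [of x "y \<otimes> z"] xyz by simp
      moreover have "c (?r1 \<otimes> ?r2) = (\<lambda>i. c ?r1 i \<noteq> c ?r2 i)" using xyz by (intro c_mult) simp_all
      ultimately show "c ?l = c (?r1 \<otimes> ?r2)"
        using c_\<beta> [OF xyz(1,2)] c_\<beta> [OF xyz(1,3)] by (simp only: cross_additive fun_eq_iff) simp
    qed (use xyz in simp_all)
    obtain x where x: "x \<in> carrier G" "c x = (\<lambda>i. i = 0)" using ex [of "\<lambda>i. i = 0"] k by auto
    obtain y where y: "y \<in> carrier G" "c y = (\<lambda>i. i = 1)" using ex [of "\<lambda>i. i = 1"] k by auto
    have "c (q (x \<otimes> y) \<otimes> inv (q x) \<otimes> inv (q y)) 5"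
      unfolding c_\<beta> [OF x(1) y(1)] x(2) y(2) by (simp add: cross_def)
    then have "q (x \<otimes> y) \<otimes> inv (q x) \<otimes> inv (q y) \<noteq> \<one>" using c_one by metis
    with x(1) y(1)
    show "\<exists>x \<in> carrier G. \<exists>y \<in> carrier G. q (x \<otimes> y) \<otimes> inv (q x) \<otimes> inv (q y) \<noteq> \<one>" by blast
    fix g x y
    assume g: "g \<in> carrier G \<rightarrow> carrier G" "g \<one> = \<one>"
      and rigid: "\<And>x y. \<lbrakk>x \<in> carrier G; y \<in> carrier G\<rbrakk> \<Longrightarrow>
        \<exists>e \<in> carrier G. g x \<otimes> inv (g y) = q (x \<otimes> inv y \<otimes> e) \<otimes> inv (q (x \<otimes> inv y)) \<otimes> inv (q e)"
      and xy: "x \<in> carrier G" "y \<in> carrier G"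
    have gc [simp]: "g u \<in> carrier G" if "u \<in> carrier G" for u using g that by blast
    have diff: "\<exists>e. (\<lambda>i. c (g u) i \<noteq> c (g v) i) = cross (\<lambda>i. c u i \<noteq> c v i) e"
      if uv: "u \<in> carrier G" "v \<in> carrier G" for u v
    proof -
      obtain e where e: "e \<in> carrier G"
        "g u \<otimes> inv (g v) = q (u \<otimes> inv v \<otimes> e) \<otimes> inv (q (u \<otimes> inv v)) \<otimes> inv (q e)"
        using rigid [OF uv] by blast
      have uv': "u \<otimes> inv v \<in> carrier G" using uv by simp
      have gu: "c (g u \<otimes> inv (g v)) = (\<lambda>i. c (g u) i \<noteq> c (g v) i)" using uv by simp
      have u: "c (u \<otimes> inv v) = (\<lambda>i. c u i \<noteq> c v i)" using uv by simp
      have "c (g u \<otimes> inv (g v)) = cross (c (u \<otimes> inv v)) (c e)"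
        unfolding e(2) by (rule c_\<beta> [OF uv' e(1)])
      then show ?thesis unfolding gu u by blast
    qed
    have orth: "\<not> dot (\<lambda>i. c (g u) i \<noteq> c (g v) i) (\<lambda>i. c u i \<noteq> c v i)"
      if uv: "u \<in> carrier G" "v \<in> carrier G" for u v
      using diff [OF uv] dot_cross by auto
    have self: "\<not> dot (c (g u)) (c u)" if "u \<in> carrier G" for u
      using orth [OF that one_closed] g(2) by simp
    have sym: "dot (c (g u)) (c v) = dot (c (g v)) (c u)"
      if uv: "u \<in> carrier G" "v \<in> carrier G" for u v
      using orth [OF uv] self [OF uv(1)] self [OF uv(2)] by (simp only: dot_additive) blast
    have additive: "dot (c (g (x \<otimes> y))) (c w) = dot (\<lambda>i. c (g x) i \<noteq> c (g y) i) (c w)"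
      if w: "w \<in> carrier G" for w
    proof -
      have "dot (c (g w)) (c (x \<otimes> y)) = (dot (c (g w)) (c x) \<noteq> dot (c (g w)) (c y))"
        unfolding c_mult [OF xy] dot_additive by blast
      then show ?thesis
        using sym [OF w m_closed [OF xy]] sym [OF w xy(1)] sym [OF w xy(2)]
        unfolding dot_additive by blast
    qed
    have unit: "dot (c (g (x \<otimes> y))) (\<lambda>i. i = j) = dot (\<lambda>i. c (g x) i \<noteq> c (g y) i) (\<lambda>i. i = j)"
      if "j < 3" for j
      using ex [of "\<lambda>i. i = j"] that k additive by force
    show "g (x \<otimes> y) = g x \<otimes> g y"
    proof (rule eqI)
      have "c (g (x \<otimes> y)) i = (c (g x) i \<noteq> c (g y) i)" for i
      proof (cases "i = 3 \<or> i = 4 \<or> i = 5")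
        case True
        then show ?thesis using unit [of 0] unit [of 1] unit [of 2] by (auto simp: dot_def)
      next
        case False
        then have "\<not> c (g u) i" if u: "u \<in> carrier G" for u
        proof -
          obtain e where "(\<lambda>i. c (g u) i \<noteq> c (g \<one>) i) = cross (\<lambda>i. c u i \<noteq> c \<one> i) e"
            using diff [OF u one_closed] by blast
          from fun_cong [OF this, of i] show ?thesis using False g(2) by (simp add: cross_def)
        qed
        then show ?thesis using xy by simp
      qed
      then show "c (g (x \<otimes> y)) = c (g x \<otimes> g y)" using xy by auto
    qed (use xy in simp_all)
  qed
qed

end

section \<open>The classification\<close>

lemma cyclic_power_two_exponent:
  assumes "y \<in> carrier (cyclic_power 2 k)"
  shows "y \<otimes>\<^bsub>cyclic_power 2 k\<^esub> y = \<one>\<^bsub>cyclic_power 2 k\<^esub>"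
  using assms by (auto simp: carrier_integer_mod_group PiE_iff intro!: restrict_ext)

lemma order_cyclic_power_two: "order (cyclic_power 2 k) = 2 ^ k"
  by (simp add: order_def carrier_integer_mod_group card_PiE)

theorem theorem1p2:
  fixes G :: "('a, 'b) monoid_scheme"
  assumes "comm_group G" and "finite (carrier G)" and "\<exists>m::nat. order G = 2 ^ m"
  shows "NCI2_group G \<longleftrightarrow>
    G \<cong> integer_mod_group 4 \<or> (\<exists>k::nat. k \<le> 5 \<and> G \<cong> cyclic_power 2 k)"
proof
  interpret comm_group G by (rule assms(1))
  assume NCI: "NCI2_group G"
  show "G \<cong> integer_mod_group 4 \<or> (\<exists>k::nat. k \<le> 5 \<and> G \<cong> cyclic_power 2 k)"
  proof (cases "\<exists>g \<in> carrier G. g \<otimes>\<^bsub>G\<^esub> g \<noteq> \<one>\<^bsub>G\<^esub>")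
    case True
    then show ?thesis using cyclic_four_or_not_NCI2_group assms(2,3) NCI by blast
  next
    case False
    then obtain k c where c: "binary_coordinates k c (carrier G)"
      using ex_binary_coordinates [OF assms(2)] by blast
    then have "k \<le> 5" using not_NCI2_group_if_six_coordinates [OF c] NCI by linarith
    then show ?thesis using iso_cyclic_power_two_if_binary_coordinates [OF c] by blast
  qed
next
  interpret comm_group G by (rule assms(1))
  assume "G \<cong> integer_mod_group 4 \<or> (\<exists>k::nat. k \<le> 5 \<and> G \<cong> cyclic_power 2 k)"
  then show "NCI2_group G"
  proof
    assume "\<exists>k::nat. k \<le> 5 \<and> G \<cong> cyclic_power 2 k"
    then obtain k where k: "k \<le> 5" "G \<cong> cyclic_power 2 k" by blast
    have gr: "group (cyclic_power 2 k)" by simp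
    have "x \<otimes>\<^bsub>G\<^esub> x = \<one>\<^bsub>G\<^esub>" if "x \<in> carrier G" for x
      using exponent_two_iso [OF gr is_group iso_sym [OF k(2)] cyclic_power_two_exponent that] .
    moreover have "order G \<le> 32"
    proof -
      have "order G = 2 ^ k"
        using iso_same_card [OF k(2)] order_cyclic_power_two [of k] by (simp add: order_def)
      also have "\<dots> \<le> 2 ^ 5" using k(1) by (intro power_increasing) simp_all
      finally show ?thesis by simp
    qed
    ultimately show ?thesis using NCI2_group_if_small_elementary [OF assms(2)] by blast
  qed (rule NCI2_group_if_cyclic_four)
qed

end
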